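(* Let $1\le n\le3$, $0<\alpha\le1$, $B>0$ fixed, $\rho_\pm>0$, and let $(\rho_+,u_+)\in \mathrm{I}(\rho_-,u_-)$. Let $A_1>0$ be such that $(\rho_+,u_+)\in R_1R_2^{AB}(\rho_-,u_-)$ for all $0<A<A_1$, and for $0<A<A_1$ let $(\rho^A,u^A)$ be the two-rarefaction-wave Riemann solution of the extended Chaplygin gas equations with Riemann data $(\rho_\pm,u_\pm)$. Then, as $A\to0$, the limit of the Riemann solution $(\rho^A,u^A)$ is two rarefaction waves (if $0<\alpha<1$), respectively two contact discontinuities (if $\alpha=1$), connecting the constant states $(\rho_\pm,u_\pm)$ and the intermediate nonvacuum state $(\rho_*,u_* )$, as follows (with $\xi=x/t$): $$\lim_{A\to0}(\rho^A,u^A)(\xi)=\begin{cases}(\rho_-,u_-), & -\infty<\xi\le u_--\sqrt{\alpha B}\,\rho_-^{-\frac{\alpha+1}{2}},\\ (\rho_*,u_* ), & u_--\sqrt{\alpha B}\,\rho_-^{-\frac{\alpha+1}{2}}\le\xi\le u_++\sqrt{\alpha B}\,\rho_+^{-\frac{\alpha+1}{2}},\\ (\rho_+,u_+), & u_++\sqrt{\alpha B}\,\rho_+^{-\frac{\alpha+1}{2}}\le\xi<\infty,\end{cases}$$ which is exactly the Riemann solution to the generalized Chaplygin gas equations (if $0<\alpha<1$), respectively the Chaplygin gas equations (if $\alpha=1$), with the same Riemann data $(\rho_\pm,u_\pm)$.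
   Context: For $A,B>0$, the extended Chaplygin gas equations are $\rho_t+(\rho u)_x=0$, $(\rho u)_t+(\rho u^2+P)_x=0$ with $P=A\rho^n-B\rho^{-\alpha}$. The generalized Chaplygin gas equations are $\rho_t+(\rho u)_x=0$, $(\rho u)_t+(\rho u^2-\frac{B}{\rho^\alpha})_x=0$; for $\alpha=1$ they are the Chaplygin gas equations. Riemann data $(\rho_\pm,u_\pm)$ means $(\rho,u)(x,0)=(\rho_\pm,u_\pm)$ for $\pm x>0$. Put $c_{AB}(\rho)=\sqrt{An\rho^{n-1}+\alpha B\rho^{-\alpha-1}}$. The region $R_1R_2^{AB}(\rho_-,u_-)$ is the set of $(\rho,u)$, $\rho>0$, with $u-u_->\big|\int_{\rho_-}^\rho\frac{c_{AB}(s)}{s}ds\big|$. The region $\mathrm{I}(\rho_-,u_-)$ (the two-rarefaction-wave, or for $\alpha=1$ two-contact-discontinuity, region of the generalized Chaplygin gas equations) is the set of $(\rho,u)$, $\rho>0$, with $u-u_->\frac{2\sqrt{\alpha B}}{1+\alpha}\big|\rho^{-\frac{\alpha+1}{2}}-\rho_-^{-\frac{\alpha+1}{2}}\big|$. For $(\rho_+,u_+)\in R_1R_2^{AB}(\rho_-,u_-)$, the two-rarefaction-wave Riemann solution is the self-similar solution (a function of $\xi=x/t$) consisting, from left to right, of: the constant state $(\rho_-,u_-)$; the 1-rarefaction wave $\xi=u-c_{AB}(\rho)$, $u-u_-=-\int_{\rho_-}^\rho\frac{c_{AB}(s)}{s}ds$, $\rho_*^A\le\rho\le\rho_-$; the constant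 state $(\rho_*^A,u_*^A)$; the 2-rarefaction wave $\xi=u+c_{AB}(\rho)$, $u_+-u=\int_\rho^{\rho_+}\frac{c_{AB}(s)}{s}ds$, $\rho_*^A\le\rho\le\rho_+$; the constant state $(\rho_+,u_+)$. Here $\rho_*^A$ is determined by $u_+-u_-=\int_{\rho_*^A}^{\rho_-}\frac{c_{AB}(s)}{s}ds+\int_{\rho_*^A}^{\rho_+}\frac{c_{AB}(s)}{s}ds$. The state $(\rho_*,u_* )=\lim_{A\to0}(\rho_*^A,u_*^A)$ is given by $$\rho_*^{-\frac{\alpha+1}{2}}=\frac{(\alpha+1)(u_+-u_-)}{4\sqrt{\alpha B}}+\frac12\Big(\rho_+^{-\frac{\alpha+1}{2}}+\rho_-^{-\frac{\alpha+1}{2}}\Big),\qquad u_*=\frac{u_++u_-}{2}+\frac{\sqrt{\alpha B}}{\alpha+1}\Big(\rho_+^{-\frac{\alpha+1}{2}}-\rho_-^{-\frac{\alpha+1}{2}}\Big).$$ The two limiting waves are the backward wave $\xi=u-\sqrt{\alpha B}\rho^{-\frac{\alpha+1}{2}}$, $u-\frac{2\sqrt{\alpha B}}{1+\alpha}\rho^{-\frac{\alpha+1}{2}}=u_--\frac{2\sqrt{\alpha B}}{1+\alpha}\rho_-^{-\frac{\alpha+1}{2}}$, $\rho_->\rho>\rho_*$, and the forward wave $\xi=u+\sqrt{\alpha B}\rho^{-\frac{\alpha+1}{2}}$, $u+\frac{2\sqrt{\alpha B}}{1+\alpha}\rho^{-\frac{\alpha+1}{2}}=u_++\frac{2\sqrt{\alpha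 B}}{1+\alpha}\rho_+^{-\frac{\alpha+1}{2}}$, $\rho_+>\rho>\rho_*$; they are rarefaction waves for $0<\alpha<1$ and contact discontinuities for $\alpha=1$.
   Formalization: The displayed limit is inconsistent: for α<1 the constant (ρ_*,u_* ) is replaced, outside u_*∓√(αB)ρ_*^{-(α+1)/2}, by the backward and forward rarefaction waves; for α=1 the limit is claimed only off the two jump lines, where the display gives two values. *)

theory Defs
  imports "HOL-Analysis.Analysis"
begin

text \<open>The components are density and velocity.\<close>

type_synonym state = "real \<times> real"

text \<open>Compactly supported C1 test functions on the whole (x,t)-plane, with their partial
  derivatives. They need not vanish on the line t = 0, so that the weak form below
  also encodes the initial data.\<close>

definition test_function ::
  "(real \<Rightarrow> real \<Rightarrow> real) \<Rightarrow> (real \<Rightarrow> real \<Rightarrow> real) \<Rightarrow> (real \<Rightarrow> real \<Rightarrow> real) \<Rightarrow> bool" where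
  "test_function \<phi> \<phi>x \<phi>t \<longleftrightarrow>
     (\<forall>x t. ((\<lambda>y. \<phi> y t) has_real_derivative \<phi>x x t) (at x)) \<and>
     (\<forall>x t. ((\<lambda>s. \<phi> x s) has_real_derivative \<phi>t x t) (at t)) \<and>
     continuous_on UNIV (\<lambda>p. \<phi>x (fst p) (snd p)) \<and>
     continuous_on UNIV (\<lambda>p. \<phi>t (fst p) (snd p)) \<and>
     (\<exists>K. compact K \<and> (\<forall>x t. (x, t) \<notin> K \<longrightarrow> \<phi> x t = 0))"

text \<open>Distributional form of the scalar balance w_t + f_x = 0 for t > 0 with w(x,0) = w0(x).\<close>

definition weak_balance ::
  "(real \<Rightarrow> real \<Rightarrow> real) \<Rightarrow> (real \<Rightarrow> real \<Rightarrow> real) \<Rightarrow> (real \<Rightarrow> real) \<Rightarrow> bool" where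
  "weak_balance w f w0 \<longleftrightarrow>
     (\<forall>\<phi> \<phi>x \<phi>t. test_function \<phi> \<phi>x \<phi>t \<longrightarrow>
        set_integrable lborel (UNIV \<times> {0<..}) (\<lambda>(x, t). w x t * \<phi>t x t + f x t * \<phi>x x t) \<and>
        integrable lborel (\<lambda>x. w0 x * \<phi> x 0) \<and>
        set_lebesgue_integral lborel (UNIV \<times> {0<..}) (\<lambda>(x, t). w x t * \<phi>t x t + f x t * \<phi>x x t)
          + integral\<^sup>L lborel (\<lambda>x. w0 x * \<phi> x 0) = 0)"

definition riemann_data :: "state \<Rightarrow> state \<Rightarrow> real \<Rightarrow> state" where
  "riemann_data L R x = (if x < 0 then L else R)"

text \<open>Weak solution of rho_t + (rho u)_x = 0, (rho u)_t + (rho u^2 + P(rho))_x = 0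
  with Riemann data L (for x < 0) and R (for x > 0).\<close>

definition weak_riemann_solution ::
  "(real \<Rightarrow> real) \<Rightarrow> state \<Rightarrow> state \<Rightarrow> (real \<Rightarrow> real \<Rightarrow> state) \<Rightarrow> bool" where
  "weak_riemann_solution P L R W \<longleftrightarrow>
     (let \<rho> = (\<lambda>x t. fst (W x t)); u = (\<lambda>x t. snd (W x t));
          \<rho>0 = (\<lambda>x. fst (riemann_data L R x)); u0 = (\<lambda>x. snd (riemann_data L R x))
      in (\<forall>x t. 0 < t \<longrightarrow> 0 < \<rho> x t) \<and>
         weak_balance \<rho> (\<lambda>x t. \<rho> x t * u x t) \<rho>0 \<and>
         weak_balance (\<lambda>x t. \<rho> x t * u x t) (\<lambda>x t. \<rho> x t * (u x t)\<^sup>2 + P (\<rho> x t))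
           (\<lambda>x. \<rho>0 x * u0 x))"

definition c_ext :: "real \<Rightarrow> real \<Rightarrow> real \<Rightarrow> real \<Rightarrow> real \<Rightarrow> real" where
  "c_ext n \<alpha> A B s = sqrt (A * n * s powr (n - 1) + \<alpha> * B * s powr (- \<alpha> - 1))"

text \<open>The interval integral is oriented: it changes sign when a and b are swapped.\<close>

definition wave_integral :: "(real \<Rightarrow> real) \<Rightarrow> real \<Rightarrow> real \<Rightarrow> real" where
  "wave_integral c a b = (LBINT s=a..b. c s / s)"

definition R1R2_region :: "real \<Rightarrow> real \<Rightarrow> real \<Rightarrow> real \<Rightarrow> state \<Rightarrow> state set" where
  "R1R2_region n \<alpha> A B = (\<lambda>(\<rho>m, um).
     {(\<rho>, u). 0 < \<rho> \<and> u - um > \<bar>wave_integral (c_ext n \<alpha> A B) \<rho>m \<rho>\<bar>})"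

text \<open>U is a function of xi = x/t and (rs, us) is the intermediate state. Neighbouring pieces agree
  at their common end point, hence the closed intervals.\<close>

definition two_rarefaction_solution ::
  "(real \<Rightarrow> real) \<Rightarrow> state \<Rightarrow> state \<Rightarrow> (real \<Rightarrow> state) \<Rightarrow> bool" where
  "two_rarefaction_solution c = (\<lambda>(\<rho>m, um) (\<rho>p, up) U.
     \<exists>rs us. 0 < rs \<and> rs \<le> \<rho>m \<and> rs \<le> \<rho>p \<and>
       up - um = wave_integral c rs \<rho>m + wave_integral c rs \<rho>p \<and>
       us - um = - wave_integral c \<rho>m rs \<and>
       (\<forall>\<xi>. \<xi> \<le> um - c \<rho>m \<longrightarrow> U \<xi> = (\<rho>m, um)) \<and>
       (\<forall>\<xi>. um - c \<rho>m \<le> \<xi> \<and> \<xi> \<le> us - c rs \<longrightarrow>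
          (case U \<xi> of (\<rho>, u) \<Rightarrow> rs \<le> \<rho> \<and> \<rho> \<le> \<rho>m \<and>
             \<xi> = u - c \<rho> \<and> u - um = - wave_integral c \<rho>m \<rho>)) \<and>
       (\<forall>\<xi>. us - c rs \<le> \<xi> \<and> \<xi> \<le> us + c rs \<longrightarrow> U \<xi> = (rs, us)) \<and>
       (\<forall>\<xi>. us + c rs \<le> \<xi> \<and> \<xi> \<le> up + c \<rho>p \<longrightarrow>
          (case U \<xi> of (\<rho>, u) \<Rightarrow> rs \<le> \<rho> \<and> \<rho> \<le> \<rho>p \<and>
             \<xi> = u + c \<rho> \<and> up - u = wave_integral c \<rho> \<rho>p)) \<and>
       (\<forall>\<xi>. up + c \<rho>p \<le> \<xi> \<longrightarrow> U \<xi> = (\<rho>p, up)))"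

definition P_gen :: "real \<Rightarrow> real \<Rightarrow> real \<Rightarrow> real" where
  "P_gen \<alpha> B \<rho> = - B / \<rho> powr \<alpha>"

definition c_gen :: "real \<Rightarrow> real \<Rightarrow> real \<Rightarrow> real" where
  "c_gen \<alpha> B \<rho> = sqrt (\<alpha> * B) * \<rho> powr (- (\<alpha> + 1) / 2)"

definition region_I :: "real \<Rightarrow> real \<Rightarrow> state \<Rightarrow> state set" where
  "region_I \<alpha> B = (\<lambda>(\<rho>m, um).
     {(\<rho>, u). 0 < \<rho> \<and>
        u - um > 2 * sqrt (\<alpha> * B) / (1 + \<alpha>) *
                   \<bar>\<rho> powr (- (\<alpha> + 1) / 2) - \<rho>m powr (- (\<alpha> + 1) / 2)\<bar>})"

text \<open>The intermediate density is specified through its power -(alpha+1)/2, a positive number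
  for data in region I; here that power is inverted.\<close>

definition rho_star :: "real \<Rightarrow> real \<Rightarrow> state \<Rightarrow> state \<Rightarrow> real" where
  "rho_star \<alpha> B = (\<lambda>(\<rho>m, um) (\<rho>p, up).
     ((\<alpha> + 1) * (up - um) / (4 * sqrt (\<alpha> * B)) +
      1 / 2 * (\<rho>p powr (- (\<alpha> + 1) / 2) + \<rho>m powr (- (\<alpha> + 1) / 2))) powr (- 2 / (\<alpha> + 1)))"

definition u_star :: "real \<Rightarrow> real \<Rightarrow> state \<Rightarrow> state \<Rightarrow> real" where
  "u_star \<alpha> B = (\<lambda>(\<rho>m, um) (\<rho>p, up).
     (up + um) / 2 +
     sqrt (\<alpha> * B) / (\<alpha> + 1) * (\<rho>p powr (- (\<alpha> + 1) / 2) - \<rho>m powr (- (\<alpha> + 1) / 2)))"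

text \<open>The case alpha < 1. The relations between u and k rho^e are the wave integrals of c_gen in
  closed form; both fans are required to have positive width in xi.\<close>

definition gen_two_rarefactions ::
  "real \<Rightarrow> real \<Rightarrow> state \<Rightarrow> state \<Rightarrow> state \<Rightarrow> (real \<Rightarrow> state) \<Rightarrow> bool" where
  "gen_two_rarefactions \<alpha> B = (\<lambda>(\<rho>m, um) (rs, us) (\<rho>p, up) U.
     (let c = c_gen \<alpha> B; k = 2 * sqrt (\<alpha> * B) / (1 + \<alpha>); e = - (\<alpha> + 1) / 2 in
       0 < rs \<and> rs < \<rho>m \<and> rs < \<rho>p \<and>
       um - c \<rho>m < us - c rs \<and> us + c rs < up + c \<rho>p \<and>
       us - k * rs powr e = um - k * \<rho>m powr e \<and>
       us + k * rs powr e = up + k * \<rho>p powr e \<and>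
       (\<forall>\<xi>. \<xi> \<le> um - c \<rho>m \<longrightarrow> U \<xi> = (\<rho>m, um)) \<and>
       (\<forall>\<xi>. um - c \<rho>m < \<xi> \<and> \<xi> < us - c rs \<longrightarrow>
          (case U \<xi> of (\<rho>, u) \<Rightarrow> rs < \<rho> \<and> \<rho> < \<rho>m \<and>
             \<xi> = u - c \<rho> \<and> u - k * \<rho> powr e = um - k * \<rho>m powr e)) \<and>
       (\<forall>\<xi>. us - c rs \<le> \<xi> \<and> \<xi> \<le> us + c rs \<longrightarrow> U \<xi> = (rs, us)) \<and>
       (\<forall>\<xi>. us + c rs < \<xi> \<and> \<xi> < up + c \<rho>p \<longrightarrow>
          (case U \<xi> of (\<rho>, u) \<Rightarrow> rs < \<rho> \<and> \<rho> < \<rho>p \<and>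
             \<xi> = u + c \<rho> \<and> u + k * \<rho> powr e = up + k * \<rho>p powr e)) \<and>
       (\<forall>\<xi>. up + c \<rho>p \<le> \<xi> \<longrightarrow> U \<xi> = (\<rho>p, up))))"

definition rankine_hugoniot :: "(real \<Rightarrow> real) \<Rightarrow> real \<Rightarrow> state \<Rightarrow> state \<Rightarrow> bool" where
  "rankine_hugoniot P \<sigma> = (\<lambda>(\<rho>l, ul) (\<rho>r, ur).
     \<sigma> * (\<rho>r - \<rho>l) = \<rho>r * ur - \<rho>l * ul \<and>
     \<sigma> * (\<rho>r * ur - \<rho>l * ul) = (\<rho>r * ur\<^sup>2 + P \<rho>r) - (\<rho>l * ul\<^sup>2 + P \<rho>l))"

text \<open>Here lam is the characteristic speed of the field under consideration.\<close>

definition contact_discontinuity ::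
  "(real \<Rightarrow> real) \<Rightarrow> (state \<Rightarrow> real) \<Rightarrow> real \<Rightarrow> state \<Rightarrow> state \<Rightarrow> bool" where
  "contact_discontinuity P lam \<sigma> L R \<longleftrightarrow>
     L \<noteq> R \<and> lam L = \<sigma> \<and> lam R = \<sigma> \<and> rankine_hugoniot P \<sigma> L R"

text \<open>The case alpha = 1. The values of U on the two jump lines are left free.\<close>

definition gen_two_contacts ::
  "real \<Rightarrow> real \<Rightarrow> state \<Rightarrow> state \<Rightarrow> state \<Rightarrow> (real \<Rightarrow> state) \<Rightarrow> bool" where
  "gen_two_contacts \<alpha> B = (\<lambda>(\<rho>m, um) (rs, us) (\<rho>p, up) U.
     (let c = c_gen \<alpha> B; \<sigma>1 = um - c \<rho>m; \<sigma>2 = up + c \<rho>p in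
       0 < rs \<and> rs < \<rho>m \<and> rs < \<rho>p \<and> \<sigma>1 < \<sigma>2 \<and>
       contact_discontinuity (P_gen \<alpha> B) (\<lambda>(\<rho>, u). u - c \<rho>) \<sigma>1 (\<rho>m, um) (rs, us) \<and>
       contact_discontinuity (P_gen \<alpha> B) (\<lambda>(\<rho>, u). u + c \<rho>) \<sigma>2 (rs, us) (\<rho>p, up) \<and>
       (\<forall>\<xi>. \<xi> < \<sigma>1 \<longrightarrow> U \<xi> = (\<rho>m, um)) \<and>
       (\<forall>\<xi>. \<sigma>1 < \<xi> \<and> \<xi> < \<sigma>2 \<longrightarrow> U \<xi> = (rs, us)) \<and>
       (\<forall>\<xi>. \<sigma>2 < \<xi> \<longrightarrow> U \<xi> = (\<rho>p, up))))"

end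

theory Submission
  imports Defs
begin

text \<open>A self-similar pair \<open>(w, f)(x / t)\<close> solves \<open>w_t + f_x = 0\<close> weakly as soon as
  \<open>g(\<xi>) = f(\<xi>) - \<xi> w(\<xi>)\<close> is continuous with \<open>g' = - w\<close> off a finite set. This covers the rarefaction
  fans of the limit (\<open>\<alpha> < 1\<close>) and its contact discontinuities (\<open>\<alpha> = 1\<close>, where continuity of \<open>g\<close> is the
  Rankine-Hugoniot condition) at once. For the convergence, the sound speeds and wave integrals for
  \<open>A > 0\<close> exceed those for \<open>A = 0\<close> by \<open>O(sqrt A)\<close>, uniformly because the intermediate density is at
  least \<open>\<rho>*\<close>. On a fan the characteristic and wave-curve equations then determine
  \<open>(1 - \<alpha>) \<rho> powr (-(\<alpha> + 1) / 2)\<close> up to \<open>O(sqrt A)\<close>: for \<open>\<alpha> < 1\<close> this gives the limit, and for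
  \<open>\<alpha> = 1\<close> the fan shrinks to a line.\<close>

subsection \<open>Self-similar weak solutions\<close>

text \<open>For smooth profiles \<open>- \<xi> w' + f' = 0\<close> is the same as
  \<open>(f - \<xi> w)' = - w\<close>. The second form asks for regularity only of the combination
  that stays continuous across a jump, so a contact needs no separate weak argument. The exponent in
  \<open>z = \<rho> powr ex\<close> is chosen so that wave curves become straight: along the 1-curve
  the velocity has slope \<open>k\<close> in \<open>z\<close> and the sound speed slope
  \<open>q\<close>, so the characteristic speed is \<open>a1 + lam * (z - zm)\<close> with
  \<open>lam = k - q\<close>. Thus \<open>lam\<close> measures genuine nonlinearity and vanishes
  exactly for \<alpha> = 1. Dividing the error estimate by \<open>lam\<close> recovers the state
  inside a fan; for \<alpha> = 1 this fails, which is why the two jump lines are excluded from the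
  pointwise limit. Every estimate is made only for \<open>\<xi> \<le> us\<close>. The symmetry
  \<open>(x, u) -> (- x, - u)\<close> carries it to the other half, and \<open>us\<close> is a safe
  cut because it lies strictly inside the intermediate state.\<close>

lemma partials_imp_has_derivative:
  fixes f fx fy :: "real \<Rightarrow> real \<Rightarrow> real"
  assumes "\<And>x y. ((\<lambda>s. f s y) has_real_derivative fx x y) (at x)"
    and "\<And>x y. ((\<lambda>s. f x s) has_real_derivative fy x y) (at y)"
    and "continuous_on UNIV (\<lambda>p. fy (fst p) (snd p))"
  shows "((\<lambda>p. f (fst p) (snd p)) has_derivative (\<lambda>d. fx x y * fst d + fy x y * snd d)) (at (x, y))"
proof -
  have "((\<lambda>(x, y). f x y) has_derivative
      (\<lambda>(dx, dy). fx x y * dx + blinfun_apply (blinfun_mult_right (fy x y)) dy))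
      (at (x, y) within UNIV \<times> UNIV)"
  proof (rule has_derivative_partialsI)
    show "((\<lambda>x. f x y) has_derivative (*) (fx x y)) (at x within UNIV)"
      using assms(1) by (simp add: has_field_derivative_def)
    show "((\<lambda>y. f x y) has_derivative blinfun_apply (blinfun_mult_right (fy x y))) (at y within UNIV)" for x y
      using assms(2)[of x y] by (simp add: has_field_derivative_def)
    have "continuous_on UNIV (\<lambda>p. blinfun_mult_right (fy (fst p) (snd p)))"
      by (intro bounded_linear.continuous_on[OF bounded_linear_blinfun_mult_right] assms)
    then show "continuous (at (x, y) within UNIV \<times> UNIV) (\<lambda>(x, y). blinfun_mult_right (fy x y))"
      by (simp add: continuous_on_eq_continuous_at case_prod_unfold)
  qed auto
  then show ?thesis by (simp add: case_prod_unfold)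
qed

text \<open>Test functions are given through partial derivatives, but the chain rule along rays
  \<open>x = \<xi> t\<close> and the uniqueness argument off the support need the joint
  derivative.\<close>

lemma test_function_has_derivative:
  assumes "test_function \<phi> \<phi>x \<phi>t"
  shows "((\<lambda>p. \<phi> (fst p) (snd p)) has_derivative (\<lambda>d. \<phi>x x t * fst d + \<phi>t x t * snd d)) (at (x, t))"
  using assms by (intro partials_imp_has_derivative) (auto simp: test_function_def)

lemma test_function_continuous:
  assumes "test_function \<phi> \<phi>x \<phi>t"
  shows "continuous_on UNIV (\<lambda>p. \<phi> (fst p) (snd p))"
  using test_function_has_derivative[OF assms] has_derivative_continuous
  by (fastforce simp: continuous_on_eq_continuous_at)

text \<open>The definition confines only \<phi> to a compact set. On the open complement \<phi> is
  locally zero, so uniqueness of the derivative forces both partials to vanish there as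
  well.\<close>

lemma test_function_support:
  assumes "test_function \<phi> \<phi>x \<phi>t"
  obtains R where "0 < R"
    and "\<And>x t. R < \<bar>x\<bar> \<or> R < \<bar>t\<bar> \<Longrightarrow> \<phi> x t = 0 \<and> \<phi>x x t = 0 \<and> \<phi>t x t = 0"
proof -
  obtain K where K: "compact K" "\<And>x t. (x, t) \<notin> K \<Longrightarrow> \<phi> x t = 0"
    using assms by (auto simp: test_function_def)
  obtain R where R: "0 < R" "\<And>p. p \<in> K \<Longrightarrow> norm p \<le> R"
    using K(1) compact_imp_bounded bounded_pos by metis
  have "\<phi> x t = 0 \<and> \<phi>x x t = 0 \<and> \<phi>t x t = 0" if "R < \<bar>x\<bar> \<or> R < \<bar>t\<bar>" for x t
  proof -
    have nK: "(x, t) \<notin> K"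
      using that R(2)[of "(x, t)"] norm_fst_le[of x t] norm_snd_le[of t x] by auto
    have "open (- K)" using K(1) by (simp add: compact_imp_closed open_Compl)
    then have "((\<lambda>p. \<phi> (fst p) (snd p)) has_derivative (\<lambda>_. 0)) (at (x, t))"
      by (intro has_derivative_transform_within_open[OF has_derivative_const[of 0], of "- K"])
        (use nK K(2) in auto)
    from has_derivative_unique[OF this test_function_has_derivative[OF assms]]
    have "(\<lambda>d. \<phi>x x t * fst d + \<phi>t x t * snd d) = (\<lambda>_. 0)" by simp
    from fun_cong[OF this, of "(1, 0)"] fun_cong[OF this, of "(0, 1)"] nK K(2)
    show ?thesis by auto
  qed
  with R(1) show ?thesis using that by blast
qed

lemma continuous_vanishing_bounded:
  fixes f :: "real \<Rightarrow> real \<Rightarrow> real"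
  assumes "continuous_on UNIV (\<lambda>p. f (fst p) (snd p))"
    and "\<And>x t. R < \<bar>x\<bar> \<or> R < \<bar>t\<bar> \<Longrightarrow> f x t = 0"
  obtains C where "0 \<le> C" "\<And>x t. \<bar>f x t\<bar> \<le> C"
proof -
  have "compact ((\<lambda>p. f (fst p) (snd p)) ` ({-R..R} \<times> {-R..R}))"
    by (intro compact_continuous_image continuous_on_subset[OF assms(1)] compact_Times) auto
  then obtain C where C: "0 < C" "\<And>p. p \<in> {-R..R} \<times> {-R..R} \<Longrightarrow> \<bar>f (fst p) (snd p)\<bar> \<le> C"
    by (auto dest!: compact_imp_bounded simp: bounded_pos)
  have "\<bar>f x t\<bar> \<le> C" for x t
  proof (cases "R < \<bar>x\<bar> \<or> R < \<bar>t\<bar>")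
    case True
    then show ?thesis using assms(2) C(1) by simp
  next
    case False
    then show ?thesis using C(2)[of "(x, t)"] by (auto simp: abs_le_iff not_less)
  qed
  with C(1) show ?thesis using that[of C] by simp
qed

lemma test_function_bounded:
  assumes "test_function \<phi> \<phi>x \<phi>t"
  obtains C where "0 \<le> C" "\<And>x t. \<bar>\<phi> x t\<bar> \<le> C" "\<And>x t. \<bar>\<phi>x x t\<bar> \<le> C" "\<And>x t. \<bar>\<phi>t x t\<bar> \<le> C"
proof -
  obtain R where R: "\<And>x t. R < \<bar>x\<bar> \<or> R < \<bar>t\<bar> \<Longrightarrow> \<phi> x t = 0 \<and> \<phi>x x t = 0 \<and> \<phi>t x t = 0"
    using test_function_support[OF assms] by metis
  obtain C0 where C0: "0 \<le> C0" "\<And>x t. \<bar>\<phi> x t\<bar> \<le> C0"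
    using continuous_vanishing_bounded[OF test_function_continuous[OF assms], of R] R by auto
  obtain C1 where C1: "0 \<le> C1" "\<And>x t. \<bar>\<phi>x x t\<bar> \<le> C1"
    using continuous_vanishing_bounded[of \<phi>x R] R assms by (auto simp: test_function_def)
  obtain C2 where C2: "0 \<le> C2" "\<And>x t. \<bar>\<phi>t x t\<bar> \<le> C2"
    using continuous_vanishing_bounded[of \<phi>t R] R assms by (auto simp: test_function_def)
  have "\<bar>\<phi> x t\<bar> \<le> C0 + C1 + C2" "\<bar>\<phi>x x t\<bar> \<le> C0 + C1 + C2" "\<bar>\<phi>t x t\<bar> \<le> C0 + C1 + C2" for x t
    using C0(1) C0(2)[of x t] C1(1) C1(2)[of x t] C2(1) C2(2)[of x t] by linarith+
  with C0(1) C1(1) C2(1) show ?thesis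
    using that[of "C0 + C1 + C2"] by simp
qed

text \<open>The factor \<open>t\<close> in the first derivative is the Jacobian of the substitution
  \<open>x = \<xi> t\<close>.\<close>

lemma test_function_ray_derivatives:
  assumes "test_function \<phi> \<phi>x \<phi>t"
  shows "((\<lambda>t. t * \<phi> (\<xi> * t) t) has_real_derivative
      \<phi> (\<xi> * t) t + t * (\<xi> * \<phi>x (\<xi> * t) t + \<phi>t (\<xi> * t) t)) (at t)"
    and "((\<lambda>\<xi>. \<phi> (\<xi> * t) t) has_real_derivative t * \<phi>x (\<xi> * t) t) (at \<xi>)"
proof -
  have "((\<lambda>t. (\<xi> * t, t)) has_derivative (\<lambda>d. (\<xi> * d, d))) (at t)"
    by (auto intro!: derivative_eq_intros)
  from has_derivative_compose[OF this test_function_has_derivative[OF assms]]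
  have "((\<lambda>t. \<phi> (\<xi> * t) t) has_derivative
      (\<lambda>d. \<phi>x (\<xi> * t) t * (\<xi> * d) + \<phi>t (\<xi> * t) t * d)) (at t)"
    by simp
  then have "((\<lambda>t. \<phi> (\<xi> * t) t) has_real_derivative \<xi> * \<phi>x (\<xi> * t) t + \<phi>t (\<xi> * t) t) (at t)"
    unfolding has_field_derivative_def
    by (rule has_derivative_eq_rhs) (simp add: fun_eq_iff algebra_simps)
  then show "((\<lambda>t. t * \<phi> (\<xi> * t) t) has_real_derivative
      \<phi> (\<xi> * t) t + t * (\<xi> * \<phi>x (\<xi> * t) t + \<phi>t (\<xi> * t) t)) (at t)"
    by (auto intro!: derivative_eq_intros simp: algebra_simps)
  have d: "((\<lambda>y. \<phi> y t) has_real_derivative \<phi>x (\<xi> * t) t) (at (\<xi> * t))"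
    using assms by (simp add: test_function_def)
  have "((\<lambda>\<xi>. \<xi> * t) has_real_derivative t) (at \<xi>)"
    by (auto intro!: derivative_eq_intros)
  from DERIV_chain2[OF d this]
  show "((\<lambda>\<xi>. \<phi> (\<xi> * t) t) has_real_derivative t * \<phi>x (\<xi> * t) t) (at \<xi>)"
    by (simp add: mult.commute)
qed

lemma test_function_measurable:
  assumes "test_function \<phi> \<phi>x \<phi>t"
  shows "case_prod \<phi> \<in> borel_measurable borel" "case_prod \<phi>x \<in> borel_measurable borel"
    "case_prod \<phi>t \<in> borel_measurable borel"
  using assms test_function_continuous[OF assms]
  by (auto intro!: borel_measurable_continuous_onI simp: test_function_def case_prod_beta)

section \<open>Integrals of bounded functions with bounded support\<close>

lemma bounded_support_integrable:
  fixes h :: "real \<Rightarrow> real"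
  assumes "h \<in> borel_measurable borel" "\<And>x. \<bar>h x\<bar> \<le> C" "\<And>x. x \<notin> {a..b} \<Longrightarrow> h x = 0"
  shows "integrable lborel h"
  by (rule integrableI_bounded_set[of "{a..b}" _ _ C])
    (use assms in \<open>auto simp: emeasure_lborel_Icc_eq\<close>)

lemma bounded_support_integrable_pair:
  fixes h :: "real \<times> real \<Rightarrow> real"
  assumes "h \<in> borel_measurable borel" "\<And>x y. \<bar>h (x, y)\<bar> \<le> C"
    and "\<And>x y. (x, y) \<notin> {a..b} \<times> {c..d} \<Longrightarrow> h (x, y) = 0"
  shows "integrable (lborel \<Otimes>\<^sub>M lborel) h"
  unfolding lborel_prod
proof (rule integrableI_bounded_set[of "{a..b} \<times> {c..d}" _ _ C])
  have "compact ({a..b} \<times> {c..d})" by (intro compact_Times) auto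
  then show "emeasure lborel ({a..b} \<times> {c..d}) < \<infinity>" "{a..b} \<times> {c..d} \<in> sets lborel"
    using emeasure_bounded_finite[OF compact_imp_bounded] by (auto simp: top.not_eq_extremum intro: borel_compact)
  show "h \<in> borel_measurable lborel"
    using assms(1) by simp
  show "AE x in lborel. x \<in> {a..b} \<times> {c..d} \<longrightarrow> norm (h x) \<le> C"
    using assms(2) by auto
  have "h x = 0" if "x \<notin> {a..b} \<times> {c..d}" for x
    using assms(3)[of "fst x" "snd x"] that by simp
  then show "AE x in lborel. x \<notin> {a..b} \<times> {c..d} \<longrightarrow> h x = 0"
    by (intro AE_I2) simp
qed

text \<open>The finite set \<open>S\<close> admits the kinks of the potential at the edges of waves;
  continuity of \<open>H\<close> is what excludes a jump contribution there. Boundedness and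
  measurability make the Lebesgue integral exist, so that it can be identified with the gauge
  integral given by the fundamental theorem.\<close>

lemma lborel_integral_eq_FTC:
  fixes h H :: "real \<Rightarrow> real"
  assumes "h \<in> borel_measurable borel" "\<And>x. \<bar>h x\<bar> \<le> C" "a \<le> b" "\<And>x. x \<notin> {a..b} \<Longrightarrow> h x = 0"
    and "finite S" "\<And>x. x \<in> {a<..<b} - S \<Longrightarrow> (H has_real_derivative h x) (at x)"
    and "continuous_on {a..b} H"
  shows "integral\<^sup>L lborel h = H b - H a"
proof -
  have "integrable lborel h"
    by (rule bounded_support_integrable) (use assms in auto)
  then have "(h has_integral integral\<^sup>L lborel h) UNIV"
    by (rule has_integral_integral_lborel)
  moreover have "(h has_integral (H b - H a)) {a..b}"
    by (rule fundamental_theorem_of_calculus_interior_strong)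
      (use assms in \<open>auto simp: has_real_derivative_iff_has_vector_derivative\<close>)
  then have "(h has_integral (H b - H a)) UNIV"
    by (rule has_integral_on_superset) (use assms(4) in auto)
  ultimately show ?thesis by (rule has_integral_unique)
qed

text \<open>Substituting \<open>x = \<xi> t\<close> and writing \<open>h(\<xi>, t) = \<phi>(\<xi> t, t)\<close>, \<open>g(\<xi>) = f(\<xi>) - \<xi> w(\<xi>)\<close>, the integrand
  becomes \<open>w \<partial>\<^sub>t(t h) + \<partial>\<^sub>\<xi>(g h)\<close>. The second term integrates to zero in \<open>\<xi>\<close>; the first one is
  integrated over \<open>t \<ge> e\<close>, leaving the initial trace as \<open>e\<close> tends to zero.\<close>

lemma selfsimilar_weak_balance:
  fixes w f :: "real \<Rightarrow> real"
  assumes w[measurable]: "w \<in> borel_measurable borel" and f[measurable]: "f \<in> borel_measurable borel"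
    and wC: "\<And>\<xi>. \<bar>w \<xi>\<bar> \<le> C" and fC: "\<And>\<xi>. \<bar>f \<xi>\<bar> \<le> C"
    and cont: "continuous_on UNIV (\<lambda>\<xi>. f \<xi> - \<xi> * w \<xi>)"
    and "finite S"
    and deriv: "\<And>\<xi>. \<xi> \<notin> S \<Longrightarrow> ((\<lambda>\<xi>. f \<xi> - \<xi> * w \<xi>) has_real_derivative - w \<xi>) (at \<xi>)"
    and wR: "(w \<longlongrightarrow> wR) at_top" and wL: "(w \<longlongrightarrow> wL) at_bot"
  shows "weak_balance (\<lambda>x t. w (x / t)) (\<lambda>x t. f (x / t)) (\<lambda>x. if x < 0 then wL else wR)"
  unfolding weak_balance_def
proof (intro allI impI)
  fix \<phi> \<phi>x \<phi>t :: "real \<Rightarrow> real \<Rightarrow> real"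
  assume \<phi>: "test_function \<phi> \<phi>x \<phi>t"
  note meas[measurable] = test_function_measurable[OF \<phi>, folded borel_prod]
  obtain R where R: "0 < R"
    and supp: "\<And>x t. R < \<bar>x\<bar> \<or> R < \<bar>t\<bar> \<Longrightarrow> \<phi> x t = 0 \<and> \<phi>x x t = 0 \<and> \<phi>t x t = 0"
    using test_function_support[OF \<phi>] by metis
  obtain D where D: "0 \<le> D" and \<phi>D: "\<And>x t. \<bar>\<phi> x t\<bar> \<le> D"
    and \<phi>xD: "\<And>x t. \<bar>\<phi>x x t\<bar> \<le> D" and \<phi>tD: "\<And>x t. \<bar>\<phi>t x t\<bar> \<le> D"
    using test_function_bounded[OF \<phi>] by metis
  have C: "0 \<le> C" using wC[of 0] by linarith
  define g where "g \<xi> = f \<xi> - \<xi> * w \<xi>" for \<xi>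
  have g[measurable]: "g \<in> borel_measurable borel" unfolding g_def by measurable
  define F where "F x t = w (x / t) * \<phi>t x t + f (x / t) * \<phi>x x t" for x t
  have F[measurable]: "case_prod F \<in> borel_measurable (borel \<Otimes>\<^sub>M borel)"
    unfolding F_def by measurable
  have FB: "\<bar>F x t\<bar> \<le> C * D + C * D" for x t
    unfolding F_def using C D
    by (intro order_trans[OF abs_triangle_ineq] add_mono)
      (auto simp: abs_mult intro!: mult_mono wC fC \<phi>xD \<phi>tD)
  define F0 where "F0 x t = indicator {0<..} t * F x t" for x t
  have F0: "integrable (lborel \<Otimes>\<^sub>M lborel) (case_prod F0)"
  proof (rule bounded_support_integrable_pair)
    show "case_prod F0 \<in> borel_measurable borel"
      unfolding F0_def borel_prod[symmetric] by measurable
    show "\<bar>case_prod F0 (x, t)\<bar> \<le> C * D + C * D" for x t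
      using FB[of x t] C D by (auto simp: F0_def indicator_def)
    show "case_prod F0 (x, t) = 0" if "(x, t) \<notin> {-R..R} \<times> {-R..R}" for x t
    proof -
      have "R < \<bar>x\<bar> \<or> R < \<bar>t\<bar>" using that by auto
      then show ?thesis using supp by (simp add: F0_def F_def)
    qed
  qed
  have F0_set: "indicator (UNIV \<times> {0<..}) p *\<^sub>R (case p of (x, t) \<Rightarrow> w (x / t) * \<phi>t x t + f (x / t) * \<phi>x x t)
      = case_prod F0 p" for p :: "real \<times> real"
    by (auto simp: F0_def F_def indicator_def split: prod.split)
  define J where "J t = (\<integral>x. F x t \<partial>lborel)" for t
  have J0: "integrable lborel (\<lambda>t. indicator {0<..} t * J t)"
    using lborel_pair.integrable_snd[OF F0] by (simp add: F0_def J_def)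
  have I: "integral\<^sup>L (lborel \<Otimes>\<^sub>M lborel) (case_prod F0) = (\<integral>t. indicator {0<..} t * J t \<partial>lborel)"
    using lborel_pair.integral_snd[OF F0] by (simp add: F0_def J_def)

  \<comment> \<open>This is the derivative of \<open>t * \<phi> (\<xi> * t) t\<close> in
    \<open>t\<close> along the ray of slope \<xi>.\<close>
  define d where "d \<xi> t = \<phi> (\<xi> * t) t + t * (\<xi> * \<phi>x (\<xi> * t) t + \<phi>t (\<xi> * t) t)" for \<xi> t
  have d[measurable]: "case_prod d \<in> borel_measurable (borel \<Otimes>\<^sub>M borel)"
    unfolding d_def by measurable
  have d0: "d \<xi> t = 0" if "R < \<bar>\<xi> * t\<bar> \<or> R < \<bar>t\<bar>" for \<xi> t
    using supp[OF that] by (simp add: d_def)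
  have dB: "\<bar>d \<xi> t\<bar> \<le> D + R * D + R * D" for \<xi> t
  proof (cases "R < \<bar>\<xi> * t\<bar> \<or> R < \<bar>t\<bar>")
    case True
    then show ?thesis using d0 D R by auto
  next
    case False
    have "d \<xi> t = \<phi> (\<xi> * t) t + (\<xi> * t) * \<phi>x (\<xi> * t) t + t * \<phi>t (\<xi> * t) t"
      by (simp add: d_def algebra_simps)
    also have "\<bar>\<dots>\<bar> \<le> \<bar>\<phi> (\<xi> * t) t\<bar> + \<bar>(\<xi> * t) * \<phi>x (\<xi> * t) t\<bar> + \<bar>t * \<phi>t (\<xi> * t) t\<bar>"
      by linarith
    also have "\<dots> \<le> D + R * D + R * D"
      unfolding abs_mult[of "\<xi> * t"] abs_mult[of t]
      using False R D by (intro add_mono mult_mono \<phi>D \<phi>xD \<phi>tD) auto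
    finally show ?thesis .
  qed
  \<comment> \<open>In the coordinates (\<xi>, t) the support is unbounded near
    \<open>t = 0\<close>. Truncating at \<open>t \<ge> e\<close> confines \<xi> to
    \<open>\<bar>\<xi>\<bar> \<le> R / e\<close>, and then boundedness alone gives the integrability
    that Fubini needs.\<close>
  have far: "R < \<bar>\<xi> * t\<bar>" if "0 < e" "e \<le> t" "\<xi> \<notin> {-(R / e)..R / e}" for \<xi> t e
  proof -
    have "R / e < \<bar>\<xi>\<bar>" using that by auto
    then have "R < \<bar>\<xi>\<bar> * e" using that by (simp add: field_simps)
    also have "\<dots> \<le> \<bar>\<xi>\<bar> * t" using that by (intro mult_left_mono) auto
    finally show ?thesis using that by (simp add: abs_mult)
  qed

  have J: "J t = (\<integral>\<xi>. w \<xi> * d \<xi> t \<partial>lborel)" if t: "0 < t" for t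
  proof -
    \<comment> \<open>The derivative of \<open>g \<xi> * \<phi> (\<xi> * t) t\<close> in \<xi>, with
      \<open>- w\<close> inserted for the derivative of \<open>g\<close>.\<close>
    define h where "h \<xi> = g \<xi> * (t * \<phi>x (\<xi> * t) t) - w \<xi> * \<phi> (\<xi> * t) t" for \<xi>
    have [measurable]: "h \<in> borel_measurable borel" unfolding h_def by measurable
    define X where "X = R / t"
    have X: "0 < X" using R t by (simp add: X_def)
    have far': "R < \<bar>\<xi> * t\<bar>" if "\<xi> \<notin> {-X..X}" for \<xi>
      using far[of t t \<xi>] that t by (simp add: X_def)
    have h0: "h \<xi> = 0" if "\<xi> \<notin> {-X..X}" for \<xi>
      using supp far'[OF that] by (simp add: h_def)
    \<comment> \<open>\<open>g\<close> contains the unbounded factor \<xi>, so a bound is available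
      only on the support in \<xi>; it comes from continuity.\<close>
    have "compact (g ` {-X..X})"
      using cont by (intro compact_continuous_image) (auto simp: g_def intro: continuous_on_subset)
    then obtain G where G: "\<And>\<xi>. \<xi> \<in> {-X..X} \<Longrightarrow> \<bar>g \<xi>\<bar> \<le> G"
      using compact_imp_bounded
      by (metis bounded_iff imageI real_norm_def)
    have G0: "0 \<le> G" using G[of 0] X by auto
    have hB: "\<bar>h \<xi>\<bar> \<le> G * (t * D) + C * D" for \<xi>
    proof (cases "\<xi> \<in> {-X..X}")
      case True
      have "\<bar>h \<xi>\<bar> \<le> \<bar>g \<xi>\<bar> * (t * \<bar>\<phi>x (\<xi> * t) t\<bar>) + \<bar>w \<xi>\<bar> * \<bar>\<phi> (\<xi> * t) t\<bar>"
        unfolding h_def using t by (intro order_trans[OF abs_triangle_ineq4]) (simp add: abs_mult)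
      also have "\<dots> \<le> G * (t * D) + C * D"
        using G[OF True] G0 C D t by (intro add_mono mult_mono wC \<phi>D \<phi>xD) auto
      finally show ?thesis .
    next
      case False
      then show ?thesis using h0 G0 C D t by auto
    qed
    \<comment> \<open>Widening \<open>X\<close> by 1 puts both end points strictly outside the
      support, so the boundary terms vanish.\<close>
    have "integral\<^sup>L lborel h = g (X + 1) * \<phi> ((X + 1) * t) t - g (-(X + 1)) * \<phi> (-(X + 1) * t) t"
    proof (rule lborel_integral_eq_FTC[where H="\<lambda>\<xi>. g \<xi> * \<phi> (\<xi> * t) t", OF _ hB _ _ \<open>finite S\<close>])
      show "((\<lambda>\<xi>. g \<xi> * \<phi> (\<xi> * t) t) has_real_derivative h \<xi>) (at \<xi>)"
        if "\<xi> \<in> {- (X + 1)<..<X + 1} - S" for \<xi>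
      proof -
        have "(g has_real_derivative - w \<xi>) (at \<xi>)"
          using deriv[of \<xi>] that unfolding g_def by blast
        from DERIV_mult[OF this test_function_ray_derivatives(2)[OF \<phi>, of t \<xi>]]
        show ?thesis by (simp add: h_def algebra_simps)
      qed
      have "continuous_on UNIV (\<lambda>\<xi>. \<phi> (\<xi> * t) t)"
        using test_function_ray_derivatives(2)[OF \<phi>]
        by (intro DERIV_continuous_on) (auto intro: DERIV_subset)
      then show "continuous_on {- (X + 1)..X + 1} (\<lambda>\<xi>. g \<xi> * \<phi> (\<xi> * t) t)"
        using cont unfolding g_def
        by (intro continuous_on_mult) (auto intro: continuous_on_subset)
    qed (use X h0 in auto)
    also have "\<dots> = 0"
    proof -
      have "\<phi> ((X + 1) * t) t = 0" "\<phi> (-(X + 1) * t) t = 0"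
        using far'[of "X + 1"] far'[of "-(X + 1)"] supp X by auto
      then show ?thesis by simp
    qed
    finally have h_int: "integral\<^sup>L lborel h = 0" .
    have "J t = \<bar>t\<bar> *\<^sub>R (\<integral>\<xi>. F (0 + t * \<xi>) t \<partial>lborel)"
      unfolding J_def using t by (intro lborel_integral_real_affine) auto
    also have "\<dots> = (\<integral>\<xi>. t * F (0 + t * \<xi>) t \<partial>lborel)"
      using t by simp
    also have "\<dots> = (\<integral>\<xi>. w \<xi> * d \<xi> t + h \<xi> \<partial>lborel)"
      using t by (intro Bochner_Integration.integral_cong)
        (auto simp: F_def d_def h_def g_def algebra_simps)
    also have "\<dots> = (\<integral>\<xi>. w \<xi> * d \<xi> t \<partial>lborel) + integral\<^sup>L lborel h"
    proof (rule Bochner_Integration.integral_add)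
      show "integrable lborel h"
        by (rule bounded_support_integrable[OF _ hB h0]) auto
      show "integrable lborel (\<lambda>\<xi>. w \<xi> * d \<xi> t)"
      proof (rule bounded_support_integrable)
        show "\<bar>w \<xi> * d \<xi> t\<bar> \<le> C * (D + R * D + R * D)" for \<xi>
          unfolding abs_mult using C by (intro mult_mono wC dB) auto
        show "w \<xi> * d \<xi> t = 0" if "\<xi> \<notin> {-X..X}" for \<xi>
          using d0 far'[OF that] by simp
      qed measurable
    qed
    finally show ?thesis using h_int by simp
  qed

  have K: "(\<integral>t. indicator {e..} t * J t \<partial>lborel) = - (\<integral>x. w (x / e) * \<phi> x e \<partial>lborel)"
    if e: "0 < e" for e
  proof -
    define G where "G \<xi> t = indicator {e..} t * (w \<xi> * d \<xi> t)" for \<xi> t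
    have G: "integrable (lborel \<Otimes>\<^sub>M lborel) (case_prod G)"
    proof (rule bounded_support_integrable_pair)
      show "case_prod G \<in> borel_measurable borel"
        unfolding G_def borel_prod[symmetric] by measurable
      have "\<bar>w \<xi> * d \<xi> t\<bar> \<le> C * (D + R * D + R * D)" for \<xi> t
        unfolding abs_mult using C by (intro mult_mono wC dB) auto
      then show "\<bar>case_prod G (\<xi>, t)\<bar> \<le> C * (D + R * D + R * D)" for \<xi> t
        using C D R by (auto simp: G_def indicator_def)
      show "case_prod G (\<xi>, t) = 0" if "(\<xi>, t) \<notin> {-(R / e)..R / e} \<times> {-R..R}" for \<xi> t
      proof (cases "e \<le> t")
        case True
        with that have "R < \<bar>\<xi> * t\<bar> \<or> R < \<bar>t\<bar>" using far[OF e, of t \<xi>] by auto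
        then show ?thesis using d0 by (simp add: G_def)
      qed (simp add: G_def)
    qed
    have in_t: "(\<integral>t. G \<xi> t \<partial>lborel) = - (e * (w \<xi> * \<phi> (e * \<xi>) e))" for \<xi>
    proof -
      \<comment> \<open>At this time \<phi> has already vanished, and \<open>T\<close> is larger
        than \<open>e\<close>; only the boundary term at \<open>e\<close> survives.\<close>
      define T where "T = R + e"
      have "(\<integral>t. indicator {e..} t * d \<xi> t \<partial>lborel) = T * \<phi> (\<xi> * T) T - e * \<phi> (\<xi> * e) e"
      proof (rule lborel_integral_eq_FTC[where H="\<lambda>t. t * \<phi> (\<xi> * t) t" and S="{}" and C="D + R * D + R * D"])
        show "(\<lambda>t. indicator {e..} t * d \<xi> t) \<in> borel_measurable borel" by measurable
        show "\<bar>indicator {e..} t * d \<xi> t\<bar> \<le> D + R * D + R * D" for t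
          using dB[of \<xi> t] R D by (auto simp: indicator_def)
        show "indicator {e..} t * d \<xi> t = 0" if "t \<notin> {e..T}" for t
          using that d0[of \<xi> t] e R by (auto simp: T_def indicator_def)
        show "((\<lambda>t. t * \<phi> (\<xi> * t) t) has_real_derivative indicator {e..} t * d \<xi> t) (at t)"
          if "t \<in> {e<..<T} - {}" for t
          using that test_function_ray_derivatives(1)[OF \<phi>, of \<xi> t] by (simp add: d_def)
        show "continuous_on {e..T} (\<lambda>t. t * \<phi> (\<xi> * t) t)"
          using test_function_ray_derivatives(1)[OF \<phi>]
          by (intro DERIV_continuous_on) (auto intro: DERIV_subset)
      qed (use R in \<open>auto simp: T_def\<close>)
      moreover have "\<phi> (\<xi> * T) T = 0"
        using supp[of "\<xi> * T" T] R e by (simp add: T_def)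
      moreover have "(\<integral>t. G \<xi> t \<partial>lborel) = w \<xi> * (\<integral>t. indicator {e..} t * d \<xi> t \<partial>lborel)"
        unfolding G_def integral_mult_right_zero[symmetric]
        by (intro Bochner_Integration.integral_cong) auto
      ultimately show ?thesis by (simp add: mult.commute mult.left_commute)
    qed
    have "(\<integral>t. indicator {e..} t * J t \<partial>lborel) = (\<integral>t. (\<integral>\<xi>. G \<xi> t \<partial>lborel) \<partial>lborel)"
      using e by (intro Bochner_Integration.integral_cong) (auto simp: G_def J indicator_def)
    also have "\<dots> = (\<integral>\<xi>. (\<integral>t. G \<xi> t \<partial>lborel) \<partial>lborel)"
      by (rule lborel_pair.Fubini_integral[OF G])
    also have "\<dots> = - (\<bar>e\<bar> *\<^sub>R (\<integral>\<xi>. w ((0 + e * \<xi>) / e) * \<phi> (0 + e * \<xi>) e \<partial>lborel))"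
      unfolding in_t using e by simp
    also have "\<dots> = - (\<integral>x. w (x / e) * \<phi> x e \<partial>lborel)"
      using e by (subst (2) lborel_integral_real_affine[of e _ 0]) auto
    finally show ?thesis .
  qed

  define w0 where "w0 x = (if x < 0 then wL else wR)" for x :: real
  have w0_int: "integrable lborel (\<lambda>x. w0 x * \<phi> x 0)"
  proof (rule bounded_support_integrable)
    show "(\<lambda>x. w0 x * \<phi> x 0) \<in> borel_measurable borel" unfolding w0_def by measurable
    show "\<bar>w0 x * \<phi> x 0\<bar> \<le> (\<bar>wL\<bar> + \<bar>wR\<bar>) * D" for x
      unfolding abs_mult by (intro mult_mono \<phi>D) (auto simp: w0_def)
    show "w0 x * \<phi> x 0 = 0" if "x \<notin> {-R..R}" for x
    proof -
      have "R < \<bar>x\<bar>" using that by auto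
      then show ?thesis using supp by simp
    qed
  qed
  define e where "e n = inverse (real (Suc n))" for n
  have e: "0 < e n" for n by (simp add: e_def)
  have e0: "e \<longlonglongrightarrow> 0" unfolding e_def by (rule LIMSEQ_inverse_real_of_nat)
  have e0R: "filterlim e (at_right 0) sequentially"
    by (rule tendsto_imp_filterlim_at_right[OF e0]) (simp add: e)
  \<comment> \<open>The dominating function comes from Fubini in the original coordinates (x, t),
    where the integrand has bounded support down to \<open>t = 0\<close>.\<close>
  have lim1: "(\<lambda>n. \<integral>t. indicator {e n..} t * J t \<partial>lborel) \<longlonglongrightarrow> (\<integral>t. indicator {0<..} t * J t \<partial>lborel)"
  proof (rule integral_dominated_convergence[where w="\<lambda>t. norm (indicator {0<..} t * J t)"])
    show "integrable lborel (\<lambda>t. norm (indicator {0<..} t * J t))" using J0 by simp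
    show m0: "(\<lambda>t. indicator {0<..} t * J t) \<in> borel_measurable lborel" using J0 by measurable
    have "(\<lambda>t. indicator {e n..} t * (indicator {0<..} t * J t)) \<in> borel_measurable lborel" for n
      using m0 by measurable
    moreover have "indicator {e n..} t * (indicator {0<..} t * J t) = indicator {e n..} t * J t" for n t
      using less_le_trans[OF e] by (auto simp: indicator_def)
    ultimately show "(\<lambda>t. indicator {e n..} t * J t) \<in> borel_measurable lborel" for n by simp
    show "AE t in lborel. (\<lambda>n. indicator {e n..} t * J t) \<longlonglongrightarrow> indicator {0<..} t * J t"
    proof (rule AE_I2, rule tendsto_eventually)
      fix t
      show "eventually (\<lambda>n. indicator {e n..} t * J t = indicator {0<..} t * J t) sequentially"
      proof (cases "0 < t")
        case True
        then have "eventually (\<lambda>n. e n < t) sequentially" using e0 by (rule order_tendstoD(2)[rotated])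
        then show ?thesis by eventually_elim (use True in \<open>auto simp: indicator_def\<close>)
      next
        case False
        then have "\<not> e n \<le> t" for n using e[of n] by linarith
        then show ?thesis using False by (auto simp: indicator_def)
      qed
    qed
    show "AE t in lborel. norm (indicator {e n..} t * J t) \<le> norm (indicator {0<..} t * J t)" for n
      using less_le_trans[OF e[of n]] by (auto simp: indicator_def)
  qed
  have lim2: "(\<lambda>n. \<integral>x. w (x / e n) * \<phi> x (e n) \<partial>lborel) \<longlonglongrightarrow> (\<integral>x. w0 x * \<phi> x 0 \<partial>lborel)"
  proof (rule integral_dominated_convergence[where w="\<lambda>x. indicator {-R..R} x * (C * D)"])
    show "(\<lambda>x. w0 x * \<phi> x 0) \<in> borel_measurable lborel" unfolding w0_def by measurable
    show "(\<lambda>x. w (x / e n) * \<phi> x (e n)) \<in> borel_measurable lborel" for n by measurable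
    show "integrable lborel (\<lambda>x. indicator {-R..R} x * (C * D))"
      by (rule bounded_support_integrable[of _ "C * D" "-R" R]) (use C D in \<open>auto simp: indicator_def\<close>)
    show "AE x in lborel. norm (w (x / e n) * \<phi> x (e n)) \<le> indicator {-R..R} x * (C * D)" for n
    proof (rule AE_I2)
      fix x
      have "\<bar>w (x / e n) * \<phi> x (e n)\<bar> \<le> C * D"
        unfolding abs_mult using C by (intro mult_mono wC \<phi>D) auto
      then show "norm (w (x / e n) * \<phi> x (e n)) \<le> indicator {-R..R} x * (C * D)"
        using supp[of x "e n"] by (cases "R < \<bar>x\<bar>") (auto simp: indicator_def)
    qed
    \<comment> \<open>For a fixed nonzero x the argument \<open>x / e n\<close> escapes to plus or
      minus infinity, so the initial trace sees only the limits of \<open>w\<close> there. The point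
      0 is a null set.\<close>
    have "(\<lambda>n. w (x / e n) * \<phi> x (e n)) \<longlonglongrightarrow> w0 x * \<phi> x 0" if x: "x \<noteq> 0" for x
    proof (rule tendsto_mult)
      have "isCont (\<lambda>t. \<phi> x t) 0"
        using \<phi> unfolding test_function_def by (blast intro: DERIV_isCont)
      then show "(\<lambda>n. \<phi> x (e n)) \<longlonglongrightarrow> \<phi> x 0"
        using e0 by (rule isCont_tendsto_compose)
      have inv: "filterlim (\<lambda>n. inverse (e n)) at_top sequentially"
        using filterlim_compose[OF filterlim_inverse_at_top_right e0R] .
      show "(\<lambda>n. w (x / e n)) \<longlonglongrightarrow> w0 x"
      proof (cases "0 < x")
        case True
        have "filterlim (\<lambda>n. x * inverse (e n)) at_top sequentially"
          by (rule filterlim_tendsto_pos_mult_at_top[OF tendsto_const True inv])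
        from filterlim_compose[OF wR this] True show ?thesis
          by (simp add: w0_def divide_inverse)
      next
        case False
        with x have "x < 0" by simp
        have "filterlim (\<lambda>n. x * inverse (e n)) at_bot sequentially"
          by (rule filterlim_tendsto_neg_mult_at_bot[OF tendsto_const \<open>x < 0\<close> inv])
        from filterlim_compose[OF wL this] \<open>x < 0\<close> show ?thesis
          by (simp add: w0_def divide_inverse)
      qed
    qed
    then show "AE x in lborel. (\<lambda>n. w (x / e n) * \<phi> x (e n)) \<longlonglongrightarrow> w0 x * \<phi> x 0"
      using AE_lborel_singleton[of 0] by auto
  qed
  have "(\<lambda>n. \<integral>t. indicator {e n..} t * J t \<partial>lborel) \<longlonglongrightarrow> - (\<integral>x. w0 x * \<phi> x 0 \<partial>lborel)"
    using tendsto_minus[OF lim2] by (simp add: K[OF e])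
  with lim1 have "(\<integral>t. indicator {0<..} t * J t \<partial>lborel) = - (\<integral>x. w0 x * \<phi> x 0 \<partial>lborel)"
    by (rule LIMSEQ_unique)
  then show "set_integrable lborel (UNIV \<times> {0<..}) (\<lambda>(x, t). w (x / t) * \<phi>t x t + f (x / t) * \<phi>x x t) \<and>
      integrable lborel (\<lambda>x. (if x < 0 then wL else wR) * \<phi> x 0) \<and>
      set_lebesgue_integral lborel (UNIV \<times> {0<..}) (\<lambda>(x, t). w (x / t) * \<phi>t x t + f (x / t) * \<phi>x x t)
        + integral\<^sup>L lborel (\<lambda>x. (if x < 0 then wL else wR) * \<phi> x 0) = 0"
    unfolding set_integrable_def set_lebesgue_integral_def F0_set
    using F0 I w0_int by (simp add: lborel_prod w0_def[symmetric])
qed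

subsection \<open>The limiting profile\<close>

text \<open>A locale, because it is interpreted a second time at the reflected data
  \<open>\<rho>p\<close>, \<open>- up\<close>, \<open>\<rho>m\<close>, \<open>- um\<close>, which
  turns facts about the left wave into facts about the right one.\<close>

locale chaplygin_data =
  fixes \<alpha> B \<rho>m um \<rho>p up :: real
  assumes \<alpha>_pos: "0 < \<alpha>" and \<alpha>_le: "\<alpha> \<le> 1" and B_pos: "0 < B"
    and \<rho>m_pos: "0 < \<rho>m" and \<rho>p_pos: "0 < \<rho>p"
    and region: "(\<rho>p, up) \<in> region_I \<alpha> B (\<rho>m, um)"
begin

text \<open>States are parametrised by \<open>z = \<rho> powr ex\<close>, with inverse \<open>dens\<close>: then the sound speed is \<open>q * z\<close>
  and the wave curves are the lines of slope \<open>k\<close> and \<open>- k\<close> in the \<open>(z, u)\<close>-plane. The numbers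
  \<open>a1\<close>, \<open>a2\<close>, \<open>a3\<close>, \<open>a4\<close> are the edges of the two fans, whose widths are proportional to \<open>lam\<close>.\<close>

definition "q = sqrt (\<alpha> * B)"
definition "k = 2 * sqrt (\<alpha> * B) / (1 + \<alpha>)"
definition "lam = k - q"
definition "ex = - (\<alpha> + 1) / 2"
definition "dens z = z powr (- 2 / (\<alpha> + 1))"
definition "zm = \<rho>m powr ex"
definition "zp = \<rho>p powr ex"
definition "zs = (\<alpha> + 1) * (up - um) / (4 * q) + 1 / 2 * (zp + zm)"
definition "us = (up + um) / 2 + q / (\<alpha> + 1) * (zp - zm)"
definition "a1 = um - q * zm"
definition "a2 = us - q * zs"
definition "a3 = us + q * zs"
definition "a4 = up + q * zp"

lemma q_pos: "0 < q" and k_pos: "0 < k"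
  using \<alpha>_pos B_pos by (simp_all add: q_def k_def)

lemma k_eq: "k * (1 + \<alpha>) = 2 * q"
  using \<alpha>_pos by (simp add: k_def q_def)

lemma q_squared: "q * q = \<alpha> * B"
  using \<alpha>_pos B_pos by (simp add: q_def)

lemma lam_eq: "lam = q * (1 - \<alpha>) / (1 + \<alpha>)"
  using \<alpha>_pos by (simp add: lam_def k_def q_def field_simps)

lemma lam_nonneg: "0 \<le> lam"
  using \<alpha>_pos \<alpha>_le q_pos by (simp add: lam_eq)

lemma lam_pos: "\<alpha> < 1 \<Longrightarrow> 0 < lam"
  using \<alpha>_pos q_pos by (simp add: lam_eq)

lemma lam_zero: "\<alpha> = 1 \<Longrightarrow> lam = 0"
  unfolding lam_eq by simp

lemma zm_pos: "0 < zm" and zp_pos: "0 < zp"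
  using \<rho>m_pos \<rho>p_pos by (simp_all add: zm_def zp_def)

lemma dens_pos: "0 < z \<Longrightarrow> 0 < dens z"
  by (simp add: dens_def)

lemma ex_inverse: "ex * (- 2 / (\<alpha> + 1)) = 1"
  using \<alpha>_pos by (simp add: ex_def divide_simps)

lemma dens_powr_ex: "0 < z \<Longrightarrow> dens z powr ex = z"
  using ex_inverse by (simp only: dens_def powr_powr mult.commute[of _ ex] powr_one)

lemma dens_of_powr: "0 < r \<Longrightarrow> dens (r powr ex) = r"
  using ex_inverse by (simp only: dens_def powr_powr powr_one)

lemma dens_zm: "dens zm = \<rho>m" and dens_zp: "dens zp = \<rho>p"
  using \<rho>m_pos \<rho>p_pos by (simp_all add: zm_def zp_def dens_of_powr)

lemma dens_strict_anti: "0 < x \<Longrightarrow> x < y \<Longrightarrow> dens y < dens x"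
  using \<alpha>_pos by (simp add: dens_def powr_less_mono2_neg)

lemma continuous_on_dens: "continuous_on {0<..} dens"
  unfolding dens_def by (intro continuous_intros) auto

lemma c_gen_eq: "c_gen \<alpha> B r = q * r powr ex"
  by (simp add: c_gen_def q_def ex_def)

text \<open>This is the intersection of the two wave curves: their velocity increments
  \<open>k * (zs - zm)\<close> and \<open>k * (zs - zp)\<close> add up to
  \<open>up - um\<close>.\<close>

lemma k_zs: "k * zs = (up - um) / 2 + k * (zp + zm) / 2"
proof -
  have "k * ((\<alpha> + 1) * (up - um) / (4 * q)) = (k * (1 + \<alpha>)) * (up - um) / (4 * q)"
    by (simp add: algebra_simps)
  also have "\<dots> = (up - um) / 2"
    using q_pos by (simp add: k_eq)
  finally have *: "k * ((\<alpha> + 1) * (up - um) / (4 * q)) = (up - um) / 2" .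
  have "k * zs = k * ((\<alpha> + 1) * (up - um) / (4 * q)) + k * (1 / 2 * (zp + zm))"
    unfolding zs_def by (rule distrib_left)
  then show ?thesis unfolding * by simp
qed

lemma us_eq: "us = (up + um) / 2 + k / 2 * (zp - zm)"
  using \<alpha>_pos by (simp add: us_def k_def q_def field_simps)

lemma us_left: "us = um + k * (zs - zm)"
  using k_zs by (simp add: us_eq field_simps)

lemma us_right: "us = up - k * (zs - zp)"
  using k_zs by (simp add: us_eq field_simps)

text \<open>Region I says exactly that both of these increments are positive: the absolute value in
  its definition combines the two inequalities.\<close>

lemma zm_less: "zm < zs" and zp_less: "zp < zs"
proof -
  have "k * \<bar>zp - zm\<bar> < up - um"
    using region by (simp add: region_I_def k_def zm_def zp_def ex_def)
  moreover have "k * (zp - zm) \<le> k * \<bar>zp - zm\<bar>" "k * (zm - zp) \<le> k * \<bar>zp - zm\<bar>"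
    using k_pos by auto
  ultimately have "0 < k * (zs - zm)" "0 < k * (zs - zp)"
    using k_zs by (auto simp: field_simps)
  then show "zm < zs" "zp < zs"
    using k_pos by (auto simp: zero_less_mult_iff)
qed

lemma zs_pos: "0 < zs"
  using zm_pos zm_less by linarith

lemma a2_eq: "a2 = a1 + lam * (zs - zm)"
  by (simp add: a2_def a1_def us_left lam_def algebra_simps)

lemma a4_eq: "a4 = a3 + lam * (zs - zp)"
  by (simp add: a3_def a4_def us_right lam_def algebra_simps)

lemma a12: "a1 \<le> a2" and a34: "a3 \<le> a4"
  using lam_nonneg zm_less zp_less by (simp_all add: a2_eq a4_eq)

lemma a2_us: "a2 < us" and us_a3: "us < a3"
  using q_pos zs_pos by (simp_all add: a2_def a3_def)

lemmas edges = a12 a2_us us_a3 a34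

text \<open>For \<open>\<alpha> = 1\<close> both fans are empty, so that the division by \<open>lam = 0\<close> is never reached.\<close>

definition "zeta \<xi> = (if \<xi> \<le> a1 then zm else if a4 \<le> \<xi> then zp
  else if \<xi> < a2 then zm + (\<xi> - a1) / lam else if a3 < \<xi> then zp + (a4 - \<xi>) / lam else zs)"

text \<open>The cut at \<open>us\<close> lies inside the intermediate state, where
  \<open>zeta\<close> equals \<open>zs\<close> and both formulas give \<open>us\<close>.\<close>

definition "vel \<xi> = (if \<xi> \<le> us then um + k * (zeta \<xi> - zm) else up - k * (zeta \<xi> - zp))"

text \<open>The strict bounds in the middle case matter for \<alpha> = 1: there
  \<open>a1 = a2\<close> and \<open>a3 = a4\<close>, and on these lines \<open>zeta\<close> takes
  the outer values \<open>zm\<close> and \<open>zp\<close>.\<close>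

lemma zeta_left: "\<xi> \<le> a1 \<Longrightarrow> zeta \<xi> = zm"
  and zeta_right: "a4 \<le> \<xi> \<Longrightarrow> zeta \<xi> = zp"
  and zeta_mid: "a1 < \<xi> \<Longrightarrow> \<xi> < a4 \<Longrightarrow> a2 \<le> \<xi> \<Longrightarrow> \<xi> \<le> a3 \<Longrightarrow> zeta \<xi> = zs"
  using edges by (auto simp: zeta_def)

lemma zeta_left_fan: "\<alpha> < 1 \<Longrightarrow> a1 \<le> \<xi> \<Longrightarrow> \<xi> \<le> a2 \<Longrightarrow> zeta \<xi> = zm + (\<xi> - a1) / lam"
  using edges lam_pos by (auto simp: zeta_def a2_eq)

lemma vel_left: "\<xi> \<le> a1 \<Longrightarrow> vel \<xi> = um"
  and vel_right: "a4 \<le> \<xi> \<Longrightarrow> vel \<xi> = up"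
  and vel_mid: "a1 < \<xi> \<Longrightarrow> \<xi> < a4 \<Longrightarrow> a2 \<le> \<xi> \<Longrightarrow> \<xi> \<le> a3 \<Longrightarrow> vel \<xi> = us"
  using edges us_left us_right by (auto simp: vel_def zeta_left zeta_right zeta_mid)

lemma vel_left_fan: "\<xi> \<le> a2 \<Longrightarrow> vel \<xi> = um + k * (zeta \<xi> - zm)"
  using edges by (auto simp: vel_def)

lemma left_fan_speed:
  assumes "\<alpha> < 1" "a1 \<le> \<xi>" "\<xi> \<le> a2"
  shows "vel \<xi> - q * zeta \<xi> = \<xi>"
proof -
  have "lam * (zeta \<xi> - zm) = \<xi> - a1"
    using assms lam_pos by (simp add: zeta_left_fan)
  then show ?thesis
    using assms(3) by (simp add: vel_left_fan lam_def a1_def algebra_simps)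
qed

lemma left_fan_bounds:
  assumes "\<alpha> < 1" "a1 < \<xi>" "\<xi> < a2"
  shows "zm < zeta \<xi>" "zeta \<xi> < zs"
  using assms lam_pos by (simp_all add: zeta_left_fan a2_eq field_simps)

lemma zeta_left_bounds: "\<xi> \<le> us \<Longrightarrow> zm \<le> zeta \<xi>" "\<xi> \<le> us \<Longrightarrow> zeta \<xi> \<le> zs"
proof -
  assume "\<xi> \<le> us"
  consider "\<xi> \<le> a1" | "a1 < \<xi>" "\<xi> < a2" | "a1 < \<xi>" "a2 \<le> \<xi>" by linarith
  then have "zm \<le> zeta \<xi> \<and> zeta \<xi> \<le> zs"
  proof cases
    case 1
    then show ?thesis using zm_less by (simp add: zeta_left)
  next
    case 2
    then have "\<alpha> < 1" using a2_eq lam_zero \<alpha>_le by (cases "\<alpha> = 1") auto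
    with 2 show ?thesis using left_fan_bounds by fastforce
  next
    case 3
    with \<open>\<xi> \<le> us\<close> show ?thesis using edges zm_less by (simp add: zeta_mid)
  qed
  then show "zm \<le> zeta \<xi>" "zeta \<xi> \<le> zs" by auto
qed

end

lemma continuous_on_atMost_glue:
  fixes f :: "real \<Rightarrow> real"
  assumes "a \<le> b" "b \<le> c"
    and "continuous_on {..a} f" "continuous_on {a..b} f" "continuous_on {b..c} f"
  shows "continuous_on {..c} f"
proof -
  have "continuous_on ({..a} \<union> {a..b} \<union> {b..c}) f"
    using assms by (intro continuous_on_closed_Un closed_Un) auto
  moreover have "{..a} \<union> {a..b} \<union> {b..c} = {..c}"
    using assms(1,2) by auto
  ultimately show ?thesis by simp
qed

context chaplygin_data
begin

text \<open>Reflecting space and velocity exchanges the two waves.\<close>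

lemma reflected: "chaplygin_data \<alpha> B \<rho>p (- up) \<rho>m (- um)"
  using region \<alpha>_pos \<alpha>_le B_pos \<rho>m_pos \<rho>p_pos
  by unfold_locales (simp_all add: region_I_def abs_minus_commute)

lemma reflected_simps:
  shows "chaplygin_data.zs \<alpha> B \<rho>p (- up) \<rho>m (- um) = zs"
    and "chaplygin_data.us \<alpha> B \<rho>p (- up) \<rho>m (- um) = - us"
    and "chaplygin_data.a1 \<alpha> B \<rho>p (- up) = - a4"
    and "chaplygin_data.a2 \<alpha> B \<rho>p (- up) \<rho>m (- um) = - a3"
    and "chaplygin_data.zm \<alpha> \<rho>p = zp"
    and "chaplygin_data.zeta \<alpha> B \<rho>p (- up) \<rho>m (- um) \<xi> = zeta (- \<xi>)"
    and "chaplygin_data.vel \<alpha> B \<rho>p (- up) \<rho>m (- um) \<xi> = - vel (- \<xi>)"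
proof -
  interpret r: chaplygin_data \<alpha> B \<rho>p "- up" \<rho>m "- um" by (rule reflected)
  have z: "r.zm = zp" "r.zp = zm"
    by (simp_all add: r.zm_def zm_def r.zp_def zp_def)
  have zs: "r.zs = zs"
    by (simp add: r.zs_def zs_def z add.commute)
  have us: "r.us = - us"
    by (simp add: r.us_def us_def z minus_add_distrib right_diff_distrib add_divide_distrib diff_divide_distrib)
  have a: "r.a1 = - a4" "r.a2 = - a3" "r.a3 = - a2" "r.a4 = - a1"
    by (simp_all add: r.a1_def r.a2_def r.a3_def r.a4_def a1_def a2_def a3_def a4_def zs us z)
  have zeta: "r.zeta \<xi> = zeta (- \<xi>)" for \<xi>
    using edges by (auto simp: r.zeta_def zeta_def a z zs algebra_simps)
  \<comment> \<open>The comparison with \<open>us\<close> in \<open>vel\<close> is closed on the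
    left and hence not symmetric under reflection. At that single point the two formulas agree by
    \<open>us_right\<close>.\<close>
  have "r.vel \<xi> = - vel (- \<xi>)"
  proof (cases "\<xi> = - us")
    case True
    have zeta_us: "zeta us = zs" and vel_us: "vel us = us"
      using edges by (auto intro: zeta_mid vel_mid)
    have "r.vel (- us) = - up + k * (zs - zp)"
      by (simp add: r.vel_def zeta us z zeta_us)
    also have "\<dots> = - us" using us_right by simp
    finally show ?thesis using True vel_us by simp
  next
    case False
    then show ?thesis by (auto simp: r.vel_def vel_def zeta us z)
  qed
  with z zs us a zeta show
    "r.zs = zs" "r.us = - us" "r.a1 = - a4" "r.a2 = - a3" "r.zm = zp" "r.zeta \<xi> = zeta (- \<xi>)" "r.vel \<xi> = - vel (- \<xi>)"
    by auto
qed

lemma zeta_bounds: "min zm zp \<le> zeta \<xi>" "zeta \<xi> \<le> zs"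
proof -
  interpret r: chaplygin_data \<alpha> B \<rho>p "- up" \<rho>m "- um" by (rule reflected)
  show "min zm zp \<le> zeta \<xi>" "zeta \<xi> \<le> zs"
    using zeta_left_bounds[of \<xi>] r.zeta_left_bounds[of "- \<xi>"]
    by (cases "\<xi> \<le> us"; force simp: reflected_simps)+
qed

lemma zeta_pos: "0 < zeta \<xi>"
  using zeta_bounds(1)[of \<xi>] zm_pos zp_pos by linarith

lemma right_fan:
  assumes "\<alpha> < 1" "a3 < \<xi>" "\<xi> < a4"
  shows "zp < zeta \<xi>" "zeta \<xi> < zs" "vel \<xi> + q * zeta \<xi> = \<xi>" "vel \<xi> = up - k * (zeta \<xi> - zp)"
proof -
  interpret r: chaplygin_data \<alpha> B \<rho>p "- up" \<rho>m "- um" by (rule reflected)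
  show "zp < zeta \<xi>" "zeta \<xi> < zs" "vel \<xi> + q * zeta \<xi> = \<xi>" "vel \<xi> = up - k * (zeta \<xi> - zp)"
    using r.left_fan_bounds[of "- \<xi>"] r.left_fan_speed[of "- \<xi>"] r.vel_left_fan[of "- \<xi>"] assms
    by (auto simp: reflected_simps)
qed

subsection \<open>The profile is a weak solution\<close>

text \<open>The combination \<open>f - \<xi> w\<close> for the mass balance, that is, the mass flux
  relative to an observer moving with speed \<xi>; \<open>mom_pot\<close> is its counterpart for
  momentum.\<close>

definition "mass_pot \<xi> = dens (zeta \<xi>) * vel \<xi> - \<xi> * dens (zeta \<xi>)"

definition "mom_pot \<xi> = dens (zeta \<xi>) * (vel \<xi>)\<^sup>2 + P_gen \<alpha> B (dens (zeta \<xi>)) - \<xi> * (dens (zeta \<xi>) * vel \<xi>)"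

lemma mom_pot_eq: "mom_pot \<xi> = mass_pot \<xi> * vel \<xi> + P_gen \<alpha> B (dens (zeta \<xi>))"
  by (simp add: mom_pot_def mass_pot_def algebra_simps power2_eq_square)

lemma mult_dens: "0 < z \<Longrightarrow> z * dens z = z powr (1 - 2 / (\<alpha> + 1))"
  unfolding dens_def by (simp add: powr_mult_base)

lemma P_gen_dens: "0 < z \<Longrightarrow> P_gen \<alpha> B (dens z) = - B * z powr (2 * \<alpha> / (\<alpha> + 1))"
proof -
  have "- 2 / (\<alpha> + 1) * \<alpha> = - (2 * \<alpha> / (\<alpha> + 1))" by simp
  then show ?thesis
    unfolding P_gen_def dens_def powr_powr by (simp only: powr_minus) (simp add: divide_inverse)
qed

text \<open>In the left fan \<open>vel \<xi> - \<xi>\<close> is the sound speed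
  \<open>q * z\<close>, so this function is \<open>mass_pot\<close> written in \<open>z\<close>. The
  factor \<open>- lam\<close> comes from \<open>q * (1 - 2 / (\<alpha> + 1)) = - lam\<close>; for
  \<alpha> = 1 the product \<open>z * dens z\<close> is constant.\<close>

lemma fan_mass_derivative:
  assumes "0 < z"
  shows "((\<lambda>z. q * (z * dens z)) has_real_derivative (- lam * dens z)) (at z)"
proof -
  have "((\<lambda>z. q * z powr (1 - 2 / (\<alpha> + 1))) has_real_derivative
      q * ((1 - 2 / (\<alpha> + 1)) * z powr (1 - 2 / (\<alpha> + 1) - 1))) (at z)"
    using assms by (intro DERIV_cmult has_real_derivative_powr)
  moreover have "q * ((1 - 2 / (\<alpha> + 1)) * z powr (1 - 2 / (\<alpha> + 1) - 1)) = - lam * dens z"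
  proof -
    have "q * (1 - 2 / (\<alpha> + 1)) = - lam"
      using \<alpha>_pos by (simp add: lam_eq field_simps)
    then show ?thesis by (simp add: dens_def flip: mult.assoc)
  qed
  ultimately have "((\<lambda>z. q * z powr (1 - 2 / (\<alpha> + 1))) has_real_derivative (- lam * dens z)) (at z)"
    by simp
  then show ?thesis
    by (rule has_field_derivative_transform_within_open[of _ _ _ "{0<..}"])
      (use assms mult_dens in auto)
qed

lemma fan_pressure_derivative:
  assumes "0 < z"
  shows "((\<lambda>z. P_gen \<alpha> B (dens z)) has_real_derivative (- k * (q * (z * dens z)))) (at z)"
proof -
  have "((\<lambda>z. - B * z powr (2 * \<alpha> / (\<alpha> + 1))) has_real_derivative
      - B * (2 * \<alpha> / (\<alpha> + 1) * z powr (2 * \<alpha> / (\<alpha> + 1) - 1))) (at z)"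
    using assms by (intro DERIV_cmult has_real_derivative_powr)
  moreover have "- B * (2 * \<alpha> / (\<alpha> + 1) * z powr (2 * \<alpha> / (\<alpha> + 1) - 1)) = - k * (q * (z * dens z))"
  proof -
    have "k * q = 2 * (q * q) / (1 + \<alpha>)" by (simp add: k_def q_def)
    then have "k * q = B * (2 * \<alpha> / (\<alpha> + 1))" by (simp add: q_squared add.commute)
    then have "- B * (2 * \<alpha> / (\<alpha> + 1) * x) = - k * (q * x)" for x
      by (metis mult.assoc mult_minus_left)
    moreover have "2 * \<alpha> / (\<alpha> + 1) - 1 = 1 - 2 / (\<alpha> + 1)"
      using \<alpha>_pos by (simp add: field_simps)
    ultimately show ?thesis
      by (simp only: mult_dens[OF assms])
  qed
  ultimately have "((\<lambda>z. - B * z powr (2 * \<alpha> / (\<alpha> + 1))) has_real_derivative (- k * (q * (z * dens z)))) (at z)"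
    by simp
  then show ?thesis
    by (rule has_field_derivative_transform_within_open[of _ _ _ "{0<..}"])
      (use assms P_gen_dens in auto)
qed

text \<open>Differentiating the velocity \<open>b + k * z\<close> contributes
  \<open>k * (q * (z * dens z))\<close>, which the pressure derivative cancels. What is left is the
  mass derivative times the velocity.\<close>

lemma fan_mom_derivative:
  assumes "0 < z"
  shows "((\<lambda>z. q * (z * dens z) * (b + k * z) + P_gen \<alpha> B (dens z)) has_real_derivative
    (- lam * (dens z * (b + k * z)))) (at z)"
proof -
  have "((\<lambda>z. b + k * z) has_real_derivative k) (at z)"
    by (auto intro!: derivative_eq_intros)
  from DERIV_add[OF DERIV_mult[OF fan_mass_derivative[OF assms] this] fan_pressure_derivative[OF assms]]
  show ?thesis by (simp add: algebra_simps)
qed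

lemma mass_pot_left_fan:
  assumes "\<alpha> < 1" "a1 \<le> \<xi>" "\<xi> \<le> a2"
  shows "mass_pot \<xi> = q * (zeta \<xi> * dens (zeta \<xi>))"
proof -
  have "mass_pot \<xi> = dens (zeta \<xi>) * (vel \<xi> - \<xi>)"
    by (simp add: mass_pot_def algebra_simps)
  also have "vel \<xi> - \<xi> = q * zeta \<xi>"
    using left_fan_speed[OF assms] by simp
  finally show ?thesis by simp
qed

lemma mom_pot_left_fan:
  assumes "\<alpha> < 1" "a1 \<le> \<xi>" "\<xi> \<le> a2"
  shows "mom_pot \<xi> = q * (zeta \<xi> * dens (zeta \<xi>)) * ((um - k * zm) + k * zeta \<xi>) + P_gen \<alpha> B (dens (zeta \<xi>))"
  using assms by (simp add: mom_pot_eq mass_pot_left_fan vel_left_fan algebra_simps)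

text \<open>For \<open>\<alpha> = 1\<close> the fan degenerates to the line \<open>\<xi> = a1 = a2\<close>, and the next two lemmas are the
  Rankine-Hugoniot conditions there.\<close>

lemma contact_mass:
  assumes "\<alpha> = 1"
  shows "\<rho>m * (um - a1) = q" "dens zs * (us - a2) = q"
proof -
  have *: "dens z * (q * z) = q" if "0 < z" for z
    using that mult_dens[OF that] assms by (simp add: mult.commute mult.left_commute)
  show "\<rho>m * (um - a1) = q" "dens zs * (us - a2) = q"
    using *[OF zm_pos] *[OF zs_pos] by (simp_all add: a1_def a2_def dens_zm)
qed

lemma contact_mom:
  assumes "\<alpha> = 1"
  shows "q * um + P_gen \<alpha> B \<rho>m = q * a1" "q * us + P_gen \<alpha> B (dens zs) = q * a1"
proof -
  have *: "P_gen \<alpha> B (dens z) = - (q * q) * z" if "0 < z" for z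
    unfolding P_gen_dens[OF that] q_squared using that assms by simp
  show "q * um + P_gen \<alpha> B \<rho>m = q * a1"
    using *[OF zm_pos] by (simp add: a1_def dens_zm algebra_simps)
  have us: "us = a1 + q * zs"
    using a2_eq lam_zero[OF assms] by (simp add: a2_def)
  show "q * us + P_gen \<alpha> B (dens zs) = q * a1"
    unfolding *[OF zs_pos] us by (simp add: algebra_simps)
qed

lemma pot_left:
  assumes "\<xi> \<le> a1"
  shows "mass_pot \<xi> = \<rho>m * um - \<xi> * \<rho>m"
    and "mom_pot \<xi> = \<rho>m * um\<^sup>2 + P_gen \<alpha> B \<rho>m - \<xi> * (\<rho>m * um)"
  using assms by (simp_all add: mass_pot_def mom_pot_def zeta_left vel_left dens_zm)

text \<open>The closed left end is the point: for \<alpha> = 1 the state at \<open>a2 = a1\<close>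
  is still the left one, yet the potentials already have their middle values.\<close>

lemma pot_mid:
  assumes "a2 \<le> \<xi>" "\<xi> \<le> us"
  shows "mass_pot \<xi> = dens zs * us - \<xi> * dens zs"
    and "mom_pot \<xi> = dens zs * us\<^sup>2 + P_gen \<alpha> B (dens zs) - \<xi> * (dens zs * us)"
proof -
  have "mass_pot \<xi> = dens zs * us - \<xi> * dens zs \<and>
    mom_pot \<xi> = dens zs * us\<^sup>2 + P_gen \<alpha> B (dens zs) - \<xi> * (dens zs * us)"
  proof (cases "a1 < \<xi>")
    case True
    then show ?thesis using assms edges by (simp add: mass_pot_def mom_pot_def zeta_mid vel_mid)
  next
    case False
    \<comment> \<open>The edges coincide, so \<open>lam = 0\<close> and \<alpha> = 1; the relative
      mass flux is \<open>q\<close> on both sides of the line, and the jump condition for momentum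
      reduces to equality of \<open>q * u + P\<close>.\<close>
    then have \<xi>: "\<xi> = a1" "\<xi> = a2" using assms a12 by auto
    then have "lam * (zs - zm) = 0" using a2_eq by simp
    then have "lam = 0" using zm_less by simp
    then have "\<not> \<alpha> < 1" using lam_pos by auto
    then have "\<alpha> = 1" using \<alpha>_le by simp
    note c = contact_mass[OF this] contact_mom[OF this]
    have m: "mass_pot \<xi> = q" using c(1) \<xi> by (simp add: pot_left algebra_simps)
    have "mom_pot \<xi> = q * um + P_gen \<alpha> B \<rho>m"
      unfolding mom_pot_eq m using \<xi> by (simp add: zeta_left vel_left dens_zm)
    also have "\<dots> = dens zs * (us - a2) * us + P_gen \<alpha> B (dens zs)"
      unfolding c(2) using c(3,4) by simp
    also have "\<dots> = dens zs * us\<^sup>2 + P_gen \<alpha> B (dens zs) - \<xi> * (dens zs * us)"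
      by (simp add: \<xi>(2) algebra_simps power2_eq_square)
    finally show ?thesis using m c(2) \<xi>(2) by (simp add: algebra_simps)
  qed
  then show "mass_pot \<xi> = dens zs * us - \<xi> * dens zs"
    "mom_pot \<xi> = dens zs * us\<^sup>2 + P_gen \<alpha> B (dens zs) - \<xi> * (dens zs * us)" by auto
qed

text \<open>The slope \<open>1 / lam\<close> of the profile cancels the factor \<open>lam\<close>.
  The affine formula stands in place of \<open>zeta\<close>, which has kinks at the fan edges, so
  that the derivative exists up to and including them.\<close>

lemma left_fan_chain:
  assumes "\<alpha> < 1" "a1 \<le> \<xi>" "\<xi> \<le> a2"
    and "\<And>z. 0 < z \<Longrightarrow> (h has_real_derivative (- lam * w z)) (at z)"
  shows "((\<lambda>\<xi>. h (zm + (\<xi> - a1) / lam)) has_real_derivative (- w (zeta \<xi>))) (at \<xi>)"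
proof -
  have "((\<lambda>\<xi>. zm + (\<xi> - a1) / lam) has_real_derivative 1 / lam) (at \<xi>)"
    using lam_pos[OF assms(1)] by (auto intro!: derivative_eq_intros)
  moreover have "(h has_real_derivative - lam * w (zeta \<xi>)) (at (zm + (\<xi> - a1) / lam))"
    using assms(4)[OF zeta_pos[of \<xi>]] zeta_left_fan[OF assms(1-3)] by simp
  ultimately have "((\<lambda>\<xi>. h (zm + (\<xi> - a1) / lam)) has_real_derivative - lam * w (zeta \<xi>) * (1 / lam)) (at \<xi>)"
    by (rule DERIV_chain2[rotated])
  then show ?thesis using lam_pos[OF assms(1)] by simp
qed

text \<open>Common to mass and momentum. Where the state is constant, \<open>G\<close> is affine
  with slope \<open>- w\<close>. The formulas for \<open>G\<close> are assumed on closed pieces and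
  those for \<open>w\<close> mostly on open ones, because only \<open>G\<close> has to match at the
  edges; this is what lets \<open>w\<close> jump when \<alpha> = 1.\<close>

lemma left_half_potential:
  fixes G w :: "real \<Rightarrow> real"
  assumes L: "\<And>\<xi>. \<xi> \<le> a1 \<Longrightarrow> G \<xi> = cL - \<xi> * wL" "\<And>\<xi>. \<xi> \<le> a1 \<Longrightarrow> w \<xi> = wL"
    and M: "\<And>\<xi>. a2 \<le> \<xi> \<Longrightarrow> \<xi> \<le> us \<Longrightarrow> G \<xi> = cM - \<xi> * wM"
      "\<And>\<xi>. a2 < \<xi> \<Longrightarrow> \<xi> \<le> us \<Longrightarrow> w \<xi> = wM"
    and F: "\<And>\<xi>. \<alpha> < 1 \<Longrightarrow> a1 \<le> \<xi> \<Longrightarrow> \<xi> \<le> a2 \<Longrightarrow> G \<xi> = h (zeta \<xi>)"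
      "\<And>\<xi>. \<alpha> < 1 \<Longrightarrow> a1 < \<xi> \<Longrightarrow> \<xi> < a2 \<Longrightarrow> w \<xi> = H (zeta \<xi>)"
      "\<And>z. 0 < z \<Longrightarrow> (h has_real_derivative (- lam * H z)) (at z)"
  shows "continuous_on {..us} G"
    and "\<And>\<xi>. \<xi> < us \<Longrightarrow> \<xi> \<notin> {a1, a2} \<Longrightarrow> (G has_real_derivative - w \<xi>) (at \<xi>)"
proof -
  have F': "G \<xi> = h (zm + (\<xi> - a1) / lam)" if "\<alpha> < 1" "a1 \<le> \<xi>" "\<xi> \<le> a2" for \<xi>
    using F(1)[OF that] zeta_left_fan[OF that] by simp
  show "continuous_on {..us} G"
  proof (rule continuous_on_atMost_glue[OF a12])
    show "continuous_on {..a1} G"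
      by (rule continuous_on_eq[of _ "\<lambda>\<xi>. cL - \<xi> * wL"]) (auto intro!: continuous_intros simp: L)
    show "continuous_on {a2..us} G"
      by (rule continuous_on_eq[of _ "\<lambda>\<xi>. cM - \<xi> * wM"]) (auto intro!: continuous_intros simp: M)
    show "continuous_on {a1..a2} G"
    proof (cases "\<alpha> = 1")
      case True
      then show ?thesis using a2_eq lam_zero by simp
    next
      case False
      then have "\<alpha> < 1" using \<alpha>_le by simp
      have "continuous_on {a1..a2} (\<lambda>\<xi>. h (zm + (\<xi> - a1) / lam))"
        by (intro DERIV_continuous_on[where D="\<lambda>\<xi>. - H (zeta \<xi>)"])
          (auto intro!: DERIV_subset[OF left_fan_chain[OF \<open>\<alpha> < 1\<close> _ _ F(3)]])
      then show ?thesis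
        by (rule continuous_on_eq) (use F' \<open>\<alpha> < 1\<close> in auto)
    qed
  qed (use a2_us in simp)
  fix \<xi> assume \<xi>: "\<xi> < us" "\<xi> \<notin> {a1, a2}"
  then consider "\<xi> < a1" | "a1 < \<xi>" "\<xi> < a2" | "a2 < \<xi>" by force
  then show "(G has_real_derivative - w \<xi>) (at \<xi>)"
  proof cases
    case 1
    have "((\<lambda>\<xi>. cL - \<xi> * wL) has_real_derivative - w \<xi>) (at \<xi>)"
      using 1 L(2) by (auto intro!: derivative_eq_intros)
    then show ?thesis
      by (rule has_field_derivative_transform_within_open[of _ _ _ "{..<a1}"]) (use 1 L in auto)
  next
    case 2
    then have "\<alpha> < 1" using a2_eq lam_zero \<alpha>_le by (cases "\<alpha> = 1") auto
    have "((\<lambda>\<xi>. h (zm + (\<xi> - a1) / lam)) has_real_derivative - w \<xi>) (at \<xi>)"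
      using left_fan_chain[OF \<open>\<alpha> < 1\<close> _ _ F(3), of \<xi>] F(2)[OF \<open>\<alpha> < 1\<close> 2] 2 by simp
    then show ?thesis
      by (rule has_field_derivative_transform_within_open[of _ _ _ "{a1<..<a2}"])
        (use 2 F' \<open>\<alpha> < 1\<close> in auto)
  next
    case 3
    have "((\<lambda>\<xi>. cM - \<xi> * wM) has_real_derivative - w \<xi>) (at \<xi>)"
      using 3 \<xi> M(2) by (auto intro!: derivative_eq_intros)
    then show ?thesis
      by (rule has_field_derivative_transform_within_open[of _ _ _ "{a2<..<us}"]) (use 3 \<xi> M in auto)
  qed
qed

lemma left_half_mass:
  shows "continuous_on {..us} mass_pot"
    and "\<And>\<xi>. \<xi> < us \<Longrightarrow> \<xi> \<notin> {a1, a2} \<Longrightarrow> (mass_pot has_real_derivative - dens (zeta \<xi>)) (at \<xi>)"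
proof -
  note * = left_half_potential[of mass_pot "\<rho>m * um" \<rho>m "\<lambda>\<xi>. dens (zeta \<xi>)" "dens zs * us" "dens zs"
    "\<lambda>z. q * (z * dens z)" dens]
  show "continuous_on {..us} mass_pot"
    by (rule *(1)) (use edges in \<open>simp_all add: pot_left pot_mid zeta_left zeta_mid dens_zm
        mass_pot_left_fan fan_mass_derivative[simplified]\<close>)
  show "(mass_pot has_real_derivative - dens (zeta \<xi>)) (at \<xi>)" if "\<xi> < us" "\<xi> \<notin> {a1, a2}" for \<xi>
    by (rule *(2)) (use edges that in \<open>simp_all add: pot_left pot_mid zeta_left zeta_mid dens_zm
        mass_pot_left_fan fan_mass_derivative[simplified]\<close>)
qed

lemma left_half_mom:
  shows "continuous_on {..us} mom_pot"
    and "\<And>\<xi>. \<xi> < us \<Longrightarrow> \<xi> \<notin> {a1, a2} \<Longrightarrow>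
      (mom_pot has_real_derivative - (dens (zeta \<xi>) * vel \<xi>)) (at \<xi>)"
proof -
  note * = left_half_potential[of mom_pot "\<rho>m * um\<^sup>2 + P_gen \<alpha> B \<rho>m" "\<rho>m * um" "\<lambda>\<xi>. dens (zeta \<xi>) * vel \<xi>"
    "dens zs * us\<^sup>2 + P_gen \<alpha> B (dens zs)" "dens zs * us"
    "\<lambda>z. q * (z * dens z) * ((um - k * zm) + k * z) + P_gen \<alpha> B (dens z)"
    "\<lambda>z. dens z * ((um - k * zm) + k * z)"]
  have v: "vel \<xi> = (um - k * zm) + k * zeta \<xi>" if "\<xi> \<le> a2" for \<xi>
    using vel_left_fan[OF that] by (simp add: algebra_simps)
  show "continuous_on {..us} mom_pot"
    by (rule *(1)) (use edges in \<open>simp_all add: pot_left pot_mid zeta_left zeta_mid vel_left vel_mid dens_zm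
        mom_pot_left_fan fan_mom_derivative[simplified] v\<close>)
  show "(mom_pot has_real_derivative - (dens (zeta \<xi>) * vel \<xi>)) (at \<xi>)" if "\<xi> < us" "\<xi> \<notin> {a1, a2}" for \<xi>
    by (rule *(2)) (use edges that in \<open>simp_all add: pot_left pot_mid zeta_left zeta_mid vel_left vel_mid dens_zm
        mom_pot_left_fan fan_mom_derivative[simplified] v\<close>)
qed

text \<open>Mass flux is odd under the reflection and momentum flux is even, as the velocity changes
  sign.\<close>

lemma reflected_potentials:
  "chaplygin_data.mass_pot \<alpha> B \<rho>p (- up) \<rho>m (- um) \<xi> = - mass_pot (- \<xi>)"
  "chaplygin_data.mom_pot \<alpha> B \<rho>p (- up) \<rho>m (- um) \<xi> = mom_pot (- \<xi>)"
proof -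
  interpret r: chaplygin_data \<alpha> B \<rho>p "- up" \<rho>m "- um" by (rule reflected)
  show "r.mass_pot \<xi> = - mass_pot (- \<xi>)" "r.mom_pot \<xi> = mom_pot (- \<xi>)"
    by (simp_all add: r.mass_pot_def mass_pot_def r.mom_pot_def mom_pot_def reflected_simps)
qed

lemma continuous_on_from_halves:
  fixes G :: "real \<Rightarrow> real"
  assumes "continuous_on {..us} G" "continuous_on {..- us} (\<lambda>\<xi>. G (- \<xi>))"
  shows "continuous_on UNIV G"
proof -
  have "continuous_on {us..} (\<lambda>\<xi>. (\<lambda>\<xi>. G (- \<xi>)) (- \<xi>))"
    by (rule continuous_on_compose2[OF assms(2)]) (auto intro!: continuous_intros)
  then have "continuous_on ({..us} \<union> {us..}) G"
    using assms(1) by (intro continuous_on_closed_Un) auto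
  moreover have "{..us} \<union> {us..} = UNIV" by auto
  ultimately show ?thesis by simp
qed

text \<open>The point \<open>us\<close> enters the exceptional set because the two half-line results
  are glued there; enlarging a finite set is harmless in the weak formulation.\<close>

lemma mass_pot_continuous: "continuous_on UNIV mass_pot"
  and mass_pot_derivative:
    "\<xi> \<notin> {a1, a2, us, a3, a4} \<Longrightarrow> (mass_pot has_real_derivative - dens (zeta \<xi>)) (at \<xi>)"
proof -
  interpret r: chaplygin_data \<alpha> B \<rho>p "- up" \<rho>m "- um" by (rule reflected)
  have "continuous_on {..- us} (\<lambda>\<xi>. - r.mass_pot \<xi>)"
    using r.left_half_mass(1) by (intro continuous_on_minus) (simp add: reflected_simps)
  then show "continuous_on UNIV mass_pot"
    by (intro continuous_on_from_halves left_half_mass) (simp add: reflected_potentials)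
  assume \<xi>: "\<xi> \<notin> {a1, a2, us, a3, a4}"
  show "(mass_pot has_real_derivative - dens (zeta \<xi>)) (at \<xi>)"
  proof (cases "\<xi> < us")
    case True
    then show ?thesis using left_half_mass(2) \<xi> by blast
  next
    case False
    have "(r.mass_pot has_real_derivative - dens (zeta \<xi>)) (at (- \<xi>))"
      using r.left_half_mass(2)[of "- \<xi>"] False \<xi> by (auto simp: reflected_simps)
    from DERIV_chain2[where g="\<lambda>x. - x" and x=\<xi>, OF this DERIV_minus[OF DERIV_ident]]
    have "((\<lambda>\<xi>. r.mass_pot (- \<xi>)) has_real_derivative dens (zeta \<xi>)) (at \<xi>)"
      by simp
    from DERIV_minus[OF this] show ?thesis by (simp add: reflected_potentials)
  qed
qed

lemma mom_pot_continuous: "continuous_on UNIV mom_pot"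
  and mom_pot_derivative:
    "\<xi> \<notin> {a1, a2, us, a3, a4} \<Longrightarrow> (mom_pot has_real_derivative - (dens (zeta \<xi>) * vel \<xi>)) (at \<xi>)"
proof -
  interpret r: chaplygin_data \<alpha> B \<rho>p "- up" \<rho>m "- um" by (rule reflected)
  have "continuous_on {..- us} r.mom_pot"
    using r.left_half_mom(1) by (simp add: reflected_simps)
  then show "continuous_on UNIV mom_pot"
    by (intro continuous_on_from_halves left_half_mom) (simp add: reflected_potentials[abs_def])
  assume \<xi>: "\<xi> \<notin> {a1, a2, us, a3, a4}"
  show "(mom_pot has_real_derivative - (dens (zeta \<xi>) * vel \<xi>)) (at \<xi>)"
  proof (cases "\<xi> < us")
    case True
    then show ?thesis using left_half_mom(2) \<xi> by blast
  next
    case False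
    have "(r.mom_pot has_real_derivative dens (zeta \<xi>) * vel \<xi>) (at (- \<xi>))"
      using r.left_half_mom(2)[of "- \<xi>"] False \<xi> by (auto simp: reflected_simps)
    from DERIV_chain2[where g="\<lambda>x. - x" and x=\<xi>, OF this DERIV_minus[OF DERIV_ident]]
    have "((\<lambda>\<xi>. r.mom_pot (- \<xi>)) has_real_derivative - (dens (zeta \<xi>) * vel \<xi>)) (at \<xi>)"
      by simp
    then show ?thesis by (simp add: reflected_potentials)
  qed
qed

section \<open>The profile in the weak formulation\<close>

definition "U \<xi> = (dens (zeta \<xi>), vel \<xi>)"

lemma vel_bounded: "\<bar>vel \<xi>\<bar> \<le> \<bar>um\<bar> + \<bar>up\<bar> + k * (2 * zs)"
proof -
  have "\<bar>k * (zeta \<xi> - zm)\<bar> \<le> k * (2 * zs)" "\<bar>k * (zeta \<xi> - zp)\<bar> \<le> k * (2 * zs)"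
    using zeta_pos[of \<xi>] zeta_bounds(2)[of \<xi>] zm_pos zp_pos zm_less zp_less k_pos
    by (auto simp: abs_mult intro!: mult_left_mono)
  then show ?thesis by (auto simp: vel_def)
qed

lemma measurable_zeta[measurable]: "zeta \<in> borel_measurable borel"
  unfolding zeta_def by measurable

lemma measurable_vel[measurable]: "vel \<in> borel_measurable borel"
  unfolding vel_def by measurable

text \<open>The pair \<open>(zeta \<xi>, vel \<xi>)\<close> stays in a compact set where the first
  coordinate is bounded away from 0, so one argument bounds densities and fluxes alike.\<close>

lemma continuous_bounded_profile:
  fixes h :: "real \<times> real \<Rightarrow> real"
  assumes "continuous_on ({0<..} \<times> UNIV) h"
  obtains C where "\<And>\<xi>. \<bar>h (zeta \<xi>, vel \<xi>)\<bar> \<le> C"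
proof -
  define V where "V = \<bar>um\<bar> + \<bar>up\<bar> + k * (2 * zs)"
  define K where "K = {min zm zp..zs} \<times> {-V..V}"
  have "K \<subseteq> {0<..} \<times> UNIV"
    using zm_pos zp_pos by (auto simp: K_def)
  then have "compact (h ` K)"
    by (intro compact_continuous_image continuous_on_subset[OF assms])
      (auto simp: K_def intro!: compact_Times)
  then obtain C where "\<And>p. p \<in> K \<Longrightarrow> \<bar>h p\<bar> \<le> C"
    using compact_imp_bounded by (metis bounded_iff imageI real_norm_def)
  moreover have "(zeta \<xi>, vel \<xi>) \<in> K" for \<xi>
    using zeta_bounds[of \<xi>] vel_bounded[of \<xi>] by (auto simp: K_def V_def abs_le_iff)
  ultimately show ?thesis using that by blast
qed

lemma tendsto_profile:
  fixes h :: "real \<Rightarrow> real \<Rightarrow> real"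
  shows "((\<lambda>\<xi>. h (zeta \<xi>) (vel \<xi>)) \<longlongrightarrow> h zm um) at_bot"
    and "((\<lambda>\<xi>. h (zeta \<xi>) (vel \<xi>)) \<longlongrightarrow> h zp up) at_top"
proof -
  show "((\<lambda>\<xi>. h (zeta \<xi>) (vel \<xi>)) \<longlongrightarrow> h zm um) at_bot"
    by (intro tendsto_eventually eventually_mono[OF eventually_le_at_bot[of a1]])
      (simp add: zeta_left vel_left)
  show "((\<lambda>\<xi>. h (zeta \<xi>) (vel \<xi>)) \<longlongrightarrow> h zp up) at_top"
    by (intro tendsto_eventually eventually_mono[OF eventually_ge_at_top[of a4]])
      (simp add: zeta_right vel_right)
qed

lemma weak_balance_profile:
  fixes w f :: "real \<Rightarrow> real \<Rightarrow> real"
  assumes "continuous_on ({0<..} \<times> UNIV) (\<lambda>p. w (fst p) (snd p))"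
    and "continuous_on ({0<..} \<times> UNIV) (\<lambda>p. f (fst p) (snd p))"
    and [measurable]: "(\<lambda>\<xi>. w (zeta \<xi>) (vel \<xi>)) \<in> borel_measurable borel"
      "(\<lambda>\<xi>. f (zeta \<xi>) (vel \<xi>)) \<in> borel_measurable borel"
    and "continuous_on UNIV (\<lambda>\<xi>. f (zeta \<xi>) (vel \<xi>) - \<xi> * w (zeta \<xi>) (vel \<xi>))"
    and "\<And>\<xi>. \<xi> \<notin> {a1, a2, us, a3, a4} \<Longrightarrow>
      ((\<lambda>\<xi>. f (zeta \<xi>) (vel \<xi>) - \<xi> * w (zeta \<xi>) (vel \<xi>)) has_real_derivative - w (zeta \<xi>) (vel \<xi>)) (at \<xi>)"
  shows "weak_balance (\<lambda>x t. w (zeta (x / t)) (vel (x / t))) (\<lambda>x t. f (zeta (x / t)) (vel (x / t)))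
    (\<lambda>x. if x < 0 then w zm um else w zp up)"
proof -
  obtain C1 where C1: "\<And>\<xi>. \<bar>w (zeta \<xi>) (vel \<xi>)\<bar> \<le> C1"
    using continuous_bounded_profile[OF assms(1)] by auto
  obtain C2 where C2: "\<And>\<xi>. \<bar>f (zeta \<xi>) (vel \<xi>)\<bar> \<le> C2"
    using continuous_bounded_profile[OF assms(2)] by auto
  from C1 C2 have "\<And>\<xi>. \<bar>w (zeta \<xi>) (vel \<xi>)\<bar> \<le> max C1 C2" "\<And>\<xi>. \<bar>f (zeta \<xi>) (vel \<xi>)\<bar> \<le> max C1 C2"
    by (auto simp: le_max_iff_disj)
  then show ?thesis
    by (intro selfsimilar_weak_balance[where S="{a1, a2, us, a3, a4}" and C="max C1 C2"])
      (use assms tendsto_profile in auto)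
qed

lemma U_weak_solution:
  "weak_riemann_solution (P_gen \<alpha> B) (\<rho>m, um) (\<rho>p, up) (\<lambda>x t. U (x / t))"
proof -
  have cd: "continuous_on ({0<..} \<times> UNIV) (\<lambda>p::real \<times> real. dens (fst p))"
    by (rule continuous_on_compose2[OF continuous_on_dens]) (auto intro!: continuous_intros)
  have cP: "continuous_on ({0<..} \<times> UNIV) (\<lambda>p::real \<times> real. P_gen \<alpha> B (dens (fst p)))"
    unfolding P_gen_def using dens_pos
    by (intro continuous_intros cd ballI) (auto simp: less_imp_neq[symmetric])
  have [measurable]: "dens \<in> borel_measurable borel" "P_gen \<alpha> B \<in> borel_measurable borel"
    unfolding dens_def P_gen_def by measurable
  have mass: "weak_balance (\<lambda>x t. dens (zeta (x / t))) (\<lambda>x t. dens (zeta (x / t)) * vel (x / t))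
    (\<lambda>x. if x < 0 then dens zm else dens zp)"
    by (rule weak_balance_profile[of "\<lambda>z v. dens z" "\<lambda>z v. dens z * v"])
      (use mass_pot_continuous mass_pot_derivative in
        \<open>auto intro!: continuous_intros cd simp: mass_pot_def[abs_def]\<close>)
  have mom: "weak_balance (\<lambda>x t. dens (zeta (x / t)) * vel (x / t))
    (\<lambda>x t. dens (zeta (x / t)) * (vel (x / t))\<^sup>2 + P_gen \<alpha> B (dens (zeta (x / t))))
    (\<lambda>x. if x < 0 then dens zm * um else dens zp * up)"
    by (rule weak_balance_profile[of "\<lambda>z v. dens z * v" "\<lambda>z v. dens z * v\<^sup>2 + P_gen \<alpha> B (dens z)"])
      (use mom_pot_continuous mom_pot_derivative in
        \<open>auto intro!: continuous_intros cd cP simp: mom_pot_def[abs_def]\<close>)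
  have rd: "(\<lambda>x. fst (riemann_data (\<rho>m, um) (\<rho>p, up) x)) = (\<lambda>x. if x < 0 then dens zm else dens zp)"
    "(\<lambda>x. fst (riemann_data (\<rho>m, um) (\<rho>p, up) x) * snd (riemann_data (\<rho>m, um) (\<rho>p, up) x)) =
      (\<lambda>x. if x < 0 then dens zm * um else dens zp * up)"
    by (auto simp: riemann_data_def dens_zm dens_zp)
  show ?thesis
    using mass mom unfolding rd[symmetric] by (simp add: weak_riemann_solution_def U_def dens_pos zeta_pos)
qed

section \<open>Wave structure of the profile\<close>

lemma rho_star_eq: "rho_star \<alpha> B (\<rho>m, um) (\<rho>p, up) = dens zs"
  by (simp add: rho_star_def dens_def zs_def q_def zp_def zm_def ex_def)

lemma u_star_eq: "u_star \<alpha> B (\<rho>m, um) (\<rho>p, up) = us"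
  by (simp add: u_star_def us_def q_def zp_def zm_def ex_def)

lemma c_gen_values:
  "c_gen \<alpha> B \<rho>m = q * zm" "c_gen \<alpha> B \<rho>p = q * zp" "0 < z \<Longrightarrow> c_gen \<alpha> B (dens z) = q * z"
  by (simp_all add: c_gen_eq zm_def zp_def dens_powr_ex)

lemma dens_zs_bounds: "0 < dens zs" "dens zs < \<rho>m" "dens zs < \<rho>p"
  using dens_pos[OF zs_pos] dens_strict_anti[OF zm_pos zm_less] dens_strict_anti[OF zp_pos zp_less]
  by (simp_all add: dens_zm dens_zp)

lemma U_rarefactions:
  assumes "\<alpha> < 1"
  shows "gen_two_rarefactions \<alpha> B (\<rho>m, um) (dens zs, us) (\<rho>p, up) U"
proof -
  have a: "a1 < a2" "a3 < a4"
    using lam_pos[OF assms] zm_less zp_less by (simp_all add: a2_eq a4_eq)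
  have L: "U \<xi> = (\<rho>m, um)" if "\<xi> \<le> a1" for \<xi>
    using that by (simp add: U_def zeta_left vel_left dens_zm)
  have R: "U \<xi> = (\<rho>p, up)" if "a4 \<le> \<xi>" for \<xi>
    using that by (simp add: U_def zeta_right vel_right dens_zp)
  have M: "U \<xi> = (dens zs, us)" if "a2 \<le> \<xi>" "\<xi> \<le> a3" for \<xi>
    using that a by (simp add: U_def zeta_mid vel_mid)
  have FL: "dens zs < dens (zeta \<xi>) \<and> dens (zeta \<xi>) < \<rho>m \<and> \<xi> = vel \<xi> - q * zeta \<xi> \<and>
      vel \<xi> - k * zeta \<xi> = um - k * zm" if "a1 < \<xi>" "\<xi> < a2" for \<xi>
    using left_fan_bounds[OF assms that] left_fan_speed[OF assms, of \<xi>] vel_left_fan[of \<xi>] that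
      dens_strict_anti[of zm "zeta \<xi>"] dens_strict_anti[of "zeta \<xi>" zs] zm_pos
    by (simp add: dens_zm algebra_simps)
  have FR: "dens zs < dens (zeta \<xi>) \<and> dens (zeta \<xi>) < \<rho>p \<and> \<xi> = vel \<xi> + q * zeta \<xi> \<and>
      vel \<xi> + k * zeta \<xi> = up + k * zp" if "a3 < \<xi>" "\<xi> < a4" for \<xi>
    using right_fan[OF assms that]
      dens_strict_anti[of zp "zeta \<xi>"] dens_strict_anti[of "zeta \<xi>" zs] zp_pos
    by (simp add: dens_zp algebra_simps)
  have e: "- (\<alpha> + 1) / 2 = ex" "2 * sqrt (\<alpha> * B) / (1 + \<alpha>) = k" by (simp_all add: ex_def k_def)
  have RI: "us - k * zs = um - k * zm" "us + k * zs = up + k * zp"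
    using us_left us_right by (simp_all add: algebra_simps)
  show ?thesis
    unfolding gen_two_rarefactions_def Let_def prod.case e c_gen_values c_gen_values(3)[OF zs_pos]
      dens_powr_ex[OF zs_pos] zm_def[symmetric] zp_def[symmetric]
      a1_def[symmetric] a2_def[symmetric] a3_def[symmetric] a4_def[symmetric]
    using dens_zs_bounds a L R M FL FR RI
    by (auto simp: U_def c_gen_values(3)[OF zeta_pos] dens_powr_ex[OF zeta_pos])
qed

lemma U_contacts:
  assumes "\<alpha> = 1"
  shows "gen_two_contacts \<alpha> B (\<rho>m, um) (dens zs, us) (\<rho>p, up) U"
proof -
  interpret r: chaplygin_data \<alpha> B \<rho>p "- up" \<rho>m "- um" by (rule reflected)
  have a: "a1 = a2" "a4 = a3"
    using a2_eq a4_eq lam_zero[OF assms] by simp_all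
  have L: "U \<xi> = (\<rho>m, um)" if "\<xi> < a1" for \<xi>
    using that by (simp add: U_def zeta_left vel_left dens_zm)
  have R: "U \<xi> = (\<rho>p, up)" if "a4 < \<xi>" for \<xi>
    using that by (simp add: U_def zeta_right vel_right dens_zp)
  have M: "U \<xi> = (dens zs, us)" if "a1 < \<xi>" "\<xi> < a4" for \<xi>
    using that a by (simp add: U_def zeta_mid vel_mid)
  have q: "\<rho>m * (um - a1) = q" "dens zs * (us - a1) = q" "\<rho>p * (a4 - up) = q" "dens zs * (a4 - us) = q"
    using contact_mass[OF assms] r.contact_mass[OF assms] a by (simp_all add: reflected_simps)
  have p: "q * um + P_gen \<alpha> B \<rho>m = q * a1" "q * us + P_gen \<alpha> B (dens zs) = q * a1"
    "- q * up + P_gen \<alpha> B \<rho>p = - q * a4" "- q * us + P_gen \<alpha> B (dens zs) = - q * a4"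
    using contact_mom[OF assms] r.contact_mom[OF assms] by (simp_all add: reflected_simps)
  \<comment> \<open>Splitting off the speed \<open>s\<close> isolates the relative mass flux
    \<open>r * (v - s)\<close>, which has the same value on both sides of the contact. The momentum
    jump condition then says only that \<open>q * v + P\<close> agrees on both sides at the left
    contact, and \<open>- q * v + P\<close> at the right one.\<close>
  have flux: "r * v\<^sup>2 + P = s * (r * v) + (r * (v - s) * v + P)" for r v s P :: real
    by (simp add: algebra_simps power2_eq_square)
  have RH1: "rankine_hugoniot (P_gen \<alpha> B) a1 (\<rho>m, um) (dens zs, us)"
    unfolding rankine_hugoniot_def prod.case flux[where s=a1] q p
    using q by (simp add: algebra_simps)
  have q': "\<rho>p * (up - a4) = - q" "dens zs * (us - a4) = - q"
    using q by (simp_all add: algebra_simps)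
  have RH2: "rankine_hugoniot (P_gen \<alpha> B) a4 (dens zs, us) (\<rho>p, up)"
    unfolding rankine_hugoniot_def prod.case flux[where s=a4] q' p
    using q by (simp add: algebra_simps)
  have speeds: "us - q * zs = a1" "us + q * zs = a4"
    using a by (simp_all add: a2_def a3_def)
  have "a1 < a4" using edges by linarith
  then show ?thesis
    unfolding gen_two_contacts_def contact_discontinuity_def Let_def prod.case c_gen_values
      c_gen_values(3)[OF zs_pos] a1_def[symmetric] a4_def[symmetric] speeds
    using dens_zs_bounds L M R RH1 RH2 by auto
qed

end

subsection \<open>Convergence as A tends to zero\<close>

lemma wave_integral_eq_integral:
  assumes "a \<le> b" "continuous_on {a..b} (\<lambda>s. c s / s)"
  shows "wave_integral c a b = integral {a..b} (\<lambda>s. c s / s)"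
  unfolding wave_integral_def
  by (rule interval_integral_eq_integral[OF assms(1) borel_integrable_atLeastAtMost'[OF assms(2)]])

lemma wave_integral_swap: "wave_integral c b a = - wave_integral c a b"
  unfolding wave_integral_def by (rule interval_integral_endpoints_reverse)

text \<open>An error \<open>d\<close> in the sound speed costs at most \<open>d / r\<close> in the
  integrand and \<open>d / r * M\<close> in the integral. It serves in both directions: with
  \<open>d = 0\<close> for the lower bound, and with \<open>r\<close> equal to the limiting
  intermediate density for the upper bound.\<close>

lemma wave_integral_le:
  assumes "a \<le> b" "0 < a" "continuous_on {a..b} c" "continuous_on {a..b} c'"
    and "\<And>s. a \<le> s \<Longrightarrow> s \<le> b \<Longrightarrow> c s \<le> c' s + d" "0 \<le> d" "0 < r" "r \<le> a" "b \<le> M"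
  shows "wave_integral c a b \<le> wave_integral c' a b + d / r * M"
proof -
  have ct: "continuous_on {a..b} (\<lambda>s. c s / s)" "continuous_on {a..b} (\<lambda>s. c' s / s)"
    using assms by (auto intro!: continuous_intros)
  have "integral {a..b} (\<lambda>s. c s / s) \<le> integral {a..b} (\<lambda>s. c' s / s + d / r)"
  proof (rule integral_le)
    show "(\<lambda>s. c s / s) integrable_on {a..b}" "(\<lambda>s. c' s / s + d / r) integrable_on {a..b}"
      using ct by (auto intro!: integrable_continuous_real continuous_intros)
    show "c s / s \<le> c' s / s + d / r" if s: "s \<in> {a..b}" for s
    proof -
      have "c s / s \<le> (c' s + d) / s"
        using assms s by (intro divide_right_mono) auto
      also have "\<dots> = c' s / s + d / s" by (simp add: add_divide_distrib)
      also have "d / s \<le> d / r"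
        using assms s by (intro divide_left_mono) auto
      finally show ?thesis by simp
    qed
  qed
  also have "\<dots> = integral {a..b} (\<lambda>s. c' s / s) + d / r * (b - a)"
    using assms(1) ct by (subst integral_add) (auto intro!: integrable_continuous_real)
  also have "\<dots> \<le> integral {a..b} (\<lambda>s. c' s / s) + d / r * M"
    using assms by (intro add_left_mono mult_left_mono) auto
  finally show ?thesis using assms(1) ct by (simp add: wave_integral_eq_integral)
qed

lemma two_rarefaction_solutionE:
  assumes "two_rarefaction_solution c (\<rho>m, um) (\<rho>p, up) V"
  obtains r v where "0 < r" "r \<le> \<rho>m" "r \<le> \<rho>p"
    "up - um = wave_integral c r \<rho>m + wave_integral c r \<rho>p"
    "v - um = - wave_integral c \<rho>m r"
    "\<forall>\<xi>. \<xi> \<le> um - c \<rho>m \<longrightarrow> V \<xi> = (\<rho>m, um)"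
    "\<forall>\<xi>. um - c \<rho>m \<le> \<xi> \<and> \<xi> \<le> v - c r \<longrightarrow>
      r \<le> fst (V \<xi>) \<and> fst (V \<xi>) \<le> \<rho>m \<and> \<xi> = snd (V \<xi>) - c (fst (V \<xi>)) \<and>
      snd (V \<xi>) - um = - wave_integral c \<rho>m (fst (V \<xi>))"
    "\<forall>\<xi>. v - c r \<le> \<xi> \<and> \<xi> \<le> v + c r \<longrightarrow> V \<xi> = (r, v)"
    "\<forall>\<xi>. v + c r \<le> \<xi> \<and> \<xi> \<le> up + c \<rho>p \<longrightarrow>
      r \<le> fst (V \<xi>) \<and> fst (V \<xi>) \<le> \<rho>p \<and> \<xi> = snd (V \<xi>) + c (fst (V \<xi>)) \<and>
      up - snd (V \<xi>) = wave_integral c (fst (V \<xi>)) \<rho>p"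
    "\<forall>\<xi>. up + c \<rho>p \<le> \<xi> \<longrightarrow> V \<xi> = (\<rho>p, up)"
  using assms unfolding two_rarefaction_solution_def case_prod_beta fst_conv snd_conv
  by (elim exE conjE) (rule that; assumption)

lemma continuous_on_c_ext:
  assumes "0 < a"
  shows "continuous_on {a..b} (c_ext n \<alpha> A B)"
  unfolding c_ext_def using assms by (intro continuous_intros ballI) auto

context chaplygin_data
begin

lemma continuous_on_c_gen:
  assumes "0 < a"
  shows "continuous_on {a..b} (c_gen \<alpha> B)"
  unfolding c_gen_def using assms by (intro continuous_intros ballI) auto

lemma c_gen_sqrt: "0 < r \<Longrightarrow> c_gen \<alpha> B r = sqrt (\<alpha> * B * r powr (- \<alpha> - 1))"
proof -
  assume "0 < r"
  have "sqrt (r powr (- \<alpha> - 1)) = r powr (- (\<alpha> + 1) / 2)"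
    by (simp add: powr_half_sqrt[symmetric] powr_powr)
  then show ?thesis by (simp add: c_gen_def real_sqrt_mult)
qed

text \<open>Subadditivity of the square root is the origin of the rate \<open>sqrt A\<close>;
  \<open>1 \<le> n\<close> makes the remaining power monotone, so its value at \<open>M\<close>
  bounds it.\<close>

lemma c_ext_bounds:
  assumes "0 < r" "r \<le> M" "0 \<le> A" "1 \<le> n"
  shows "c_gen \<alpha> B r \<le> c_ext n \<alpha> A B r"
    and "c_ext n \<alpha> A B r \<le> c_gen \<alpha> B r + sqrt A * sqrt (n * M powr (n - 1))"
proof -
  show "c_gen \<alpha> B r \<le> c_ext n \<alpha> A B r"
    unfolding c_gen_sqrt[OF assms(1)] c_ext_def using assms by simp
  have "c_ext n \<alpha> A B r \<le> sqrt (A * (n * r powr (n - 1))) + sqrt (\<alpha> * B * r powr (- \<alpha> - 1))"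
    unfolding c_ext_def mult.assoc[of A]
    using assms \<alpha>_pos B_pos by (intro sqrt_add_le_add_sqrt) auto
  also have "sqrt (A * (n * r powr (n - 1))) \<le> sqrt A * sqrt (n * M powr (n - 1))"
    unfolding real_sqrt_mult[of A] using assms
    by (intro mult_left_mono real_sqrt_le_mono powr_mono2) auto
  finally show "c_ext n \<alpha> A B r \<le> c_gen \<alpha> B r + sqrt A * sqrt (n * M powr (n - 1))"
    by (simp add: c_gen_sqrt[OF assms(1)])
qed

text \<open>As \<open>k * ex = - q\<close>, the function \<open>- k * s powr ex\<close> is a
  primitive of the integrand.\<close>

lemma wave_integral_c_gen:
  assumes "0 < a" "a \<le> b"
  shows "wave_integral (c_gen \<alpha> B) a b = k * (a powr ex - b powr ex)"
proof -
  have kex: "k * ex = - q" using k_eq by (simp add: ex_def algebra_simps)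
  have "((\<lambda>s. c_gen \<alpha> B s / s) has_integral (- k * b powr ex - (- k * a powr ex))) {a..b}"
  proof (rule fundamental_theorem_of_calculus[OF assms(2)])
    fix s assume s: "s \<in> {a..b}"
    then have "0 < s" using assms by simp
    then have "((\<lambda>s. - k * s powr ex) has_real_derivative - k * (ex * s powr (ex - 1))) (at s)"
      by (intro DERIV_cmult has_real_derivative_powr)
    moreover have "- k * (ex * s powr (ex - 1)) = c_gen \<alpha> B s / s"
      using \<open>0 < s\<close> kex by (simp add: c_gen_eq powr_diff flip: mult.assoc)
    ultimately show "((\<lambda>s. - k * s powr ex) has_vector_derivative c_gen \<alpha> B s / s) (at s within {a..b})"
      by (simp add: has_real_derivative_iff_has_vector_derivative has_vector_derivative_at_within)
  qed
  moreover have "continuous_on {a..b} (\<lambda>s. c_gen \<alpha> B s / s)"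
    using assms by (auto intro!: continuous_intros continuous_on_c_gen)
  ultimately show ?thesis
    using assms(2) by (simp add: wave_integral_eq_integral integral_unique algebra_simps)
qed

text \<open>For \<open>\<xi> \<le> us\<close> the 2-wave lies strictly to the right of \<xi> once
  \<open>A\<close> is small, so only the left state, the 1-wave and the intermediate state
  occur.\<close>

lemma left_half_limit:
  assumes n: "1 \<le> n" and A1: "0 < A1"
    and sol: "\<And>A. 0 < A \<Longrightarrow> A < A1 \<Longrightarrow>
      two_rarefaction_solution (c_ext n \<alpha> A B) (\<rho>m, um) (\<rho>p, up) (UA A)"
    and \<xi>: "\<xi> \<le> us" and off_line: "\<alpha> = 1 \<Longrightarrow> \<xi> \<noteq> a1"
  shows "((\<lambda>A. UA A \<xi>) \<longlongrightarrow> U \<xi>) (at_right 0)"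
proof -
  define c where "c A = c_ext n \<alpha> A B" for A
  \<comment> \<open>Everything needed about the intermediate state at this one \<xi>, packed into a
    predicate so that it can be chosen as a function of \<open>A\<close>. Integrals are oriented
    from the smaller density upwards.\<close>
  define Q where "Q A r v \<longleftrightarrow> 0 < r \<and> r \<le> \<rho>m \<and> r \<le> \<rho>p \<and>
       up - um = wave_integral (c A) r \<rho>m + wave_integral (c A) r \<rho>p \<and>
       v - um = wave_integral (c A) r \<rho>m \<and>
       (\<xi> \<le> um - c A \<rho>m \<longrightarrow> UA A \<xi> = (\<rho>m, um)) \<and>
       (um - c A \<rho>m \<le> \<xi> \<and> \<xi> \<le> v - c A r \<longrightarrow>
          r \<le> fst (UA A \<xi>) \<and> fst (UA A \<xi>) \<le> \<rho>m \<and> \<xi> = snd (UA A \<xi>) - c A (fst (UA A \<xi>)) \<and>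
          snd (UA A \<xi>) - um = wave_integral (c A) (fst (UA A \<xi>)) \<rho>m) \<and>
       (v - c A r \<le> \<xi> \<and> \<xi> \<le> v + c A r \<longrightarrow> UA A \<xi> = (r, v))" for A r v
  have "\<exists>r v. Q A r v" if A: "0 < A" "A < A1" for A
  proof -
    obtain r v where *: "0 < r" "r \<le> \<rho>m" "r \<le> \<rho>p"
      "up - um = wave_integral (c A) r \<rho>m + wave_integral (c A) r \<rho>p"
      "v - um = - wave_integral (c A) \<rho>m r"
      "\<forall>\<xi>. \<xi> \<le> um - c A \<rho>m \<longrightarrow> UA A \<xi> = (\<rho>m, um)"
      "\<forall>\<xi>. um - c A \<rho>m \<le> \<xi> \<and> \<xi> \<le> v - c A r \<longrightarrow>
        r \<le> fst (UA A \<xi>) \<and> fst (UA A \<xi>) \<le> \<rho>m \<and> \<xi> = snd (UA A \<xi>) - c A (fst (UA A \<xi>)) \<and>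
        snd (UA A \<xi>) - um = - wave_integral (c A) \<rho>m (fst (UA A \<xi>))"
      "\<forall>\<xi>. v - c A r \<le> \<xi> \<and> \<xi> \<le> v + c A r \<longrightarrow> UA A \<xi> = (r, v)"
      by (rule two_rarefaction_solutionE[OF sol[OF A, folded c_def]])
    have "Q A r v"
      unfolding Q_def
      using *(1-5) *(6)[rule_format, of \<xi>] *(7)[rule_format, of \<xi>] *(8)[rule_format, of \<xi>]
        wave_integral_swap[of "c A" \<rho>m r] wave_integral_swap[of "c A" \<rho>m "fst (UA A \<xi>)"]
      by (intro conjI impI) (linarith | blast)+
    then show ?thesis by blast
  qed
  then obtain r v where "\<And>A. 0 < A \<Longrightarrow> A < A1 \<Longrightarrow> Q A (r A) (v A)"
    by metis
  then have r: "0 < r A" "r A \<le> \<rho>m" "r A \<le> \<rho>p"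
    and jump: "up - um = wave_integral (c A) (r A) \<rho>m + wave_integral (c A) (r A) \<rho>p"
    and v_eq: "v A - um = wave_integral (c A) (r A) \<rho>m"
    and state_L: "\<xi> \<le> um - c A \<rho>m \<Longrightarrow> UA A \<xi> = (\<rho>m, um)"
    and fan: "um - c A \<rho>m \<le> \<xi> \<Longrightarrow> \<xi> \<le> v A - c A (r A) \<Longrightarrow>
      r A \<le> fst (UA A \<xi>) \<and> fst (UA A \<xi>) \<le> \<rho>m \<and> \<xi> = snd (UA A \<xi>) - c A (fst (UA A \<xi>)) \<and>
      snd (UA A \<xi>) - um = wave_integral (c A) (fst (UA A \<xi>)) \<rho>m"
    and state_M: "v A - c A (r A) \<le> \<xi> \<Longrightarrow> \<xi> \<le> v A + c A (r A) \<Longrightarrow> UA A \<xi> = (r A, v A)"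
    if "0 < A" "A < A1" for A
    using that unfolding Q_def by blast+

  \<comment> \<open>\<open>M\<close> bounds all densities that occur, \<open>\<delta> A\<close> is
    the error of the sound speed, and \<open>\<epsilon> A\<close> that of a wave integral over
    densities at least \<open>dens zs\<close>.\<close>
  define M where "M = max \<rho>m \<rho>p"
  define \<delta> where "\<delta> A = sqrt A * sqrt (n * M powr (n - 1))" for A
  define \<epsilon> where "\<epsilon> A = \<delta> A / dens zs * M" for A
  have \<delta>_nonneg: "0 \<le> \<delta> A" if "0 < A" for A
    using that n by (simp add: \<delta>_def)
  have "((\<lambda>A. sqrt A) \<longlongrightarrow> 0) (at_right 0)"
    using tendsto_real_sqrt[OF tendsto_ident_at, of 0 "{0<..}"] by simp
  then have \<delta>0: "(\<delta> \<longlongrightarrow> 0) (at_right 0)"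
    unfolding \<delta>_def by (intro tendsto_mult_left_zero)
  then have \<epsilon>0: "(\<epsilon> \<longlongrightarrow> 0) (at_right 0)"
    unfolding \<epsilon>_def by (intro tendsto_mult_left_zero tendsto_divide_zero)
  have c_gen_bounds: "c_gen \<alpha> B s \<le> c A s" "c A s \<le> c_gen \<alpha> B s + \<delta> A"
    if "0 < A" "0 < s" "s \<le> M" for A s
    using c_ext_bounds[OF that(2,3), of A n] that n by (simp_all add: c_def \<delta>_def)
  note c_bounds = c_gen_bounds[unfolded c_gen_eq]
  have c_cont: "continuous_on {a..b} (c A)" if "0 < a" for A a b
    unfolding c_def by (rule continuous_on_c_ext[OF that])
  have W_lower: "k * (a powr ex - b powr ex) \<le> wave_integral (c A) a b"
    if "0 < A" "0 < a" "a \<le> b" "b \<le> M" for A a b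
  proof -
    have "wave_integral (c_gen \<alpha> B) a b \<le> wave_integral (c A) a b + 0 / a * M"
      by (rule wave_integral_le) (use that c_gen_bounds(1)[OF that(1)] in
        \<open>auto intro!: c_cont continuous_on_c_gen\<close>)
    then show ?thesis using that by (simp add: wave_integral_c_gen)
  qed
  \<comment> \<open>Since the wave integrals grow with \<open>A\<close>, the intermediate density stays above its limit; this is
    what makes all error bounds uniform away from the vacuum.\<close>
  have r_lower: "dens zs \<le> r A" "r A powr ex \<le> zs" if A: "0 < A" "A < A1" for A
  proof -
    have "k * (r A powr ex - zm) + k * (r A powr ex - zp) \<le> up - um"
      using jump[OF A] W_lower[OF A(1) r(1)[OF A] r(2)[OF A]] W_lower[OF A(1) r(1)[OF A] r(3)[OF A]]
      by (simp add: M_def zm_def zp_def)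
    also have "\<dots> = k * (zs - zm) + k * (zs - zp)"
      using us_left us_right by simp
    finally have "k * (r A powr ex) \<le> k * zs" by (simp add: algebra_simps)
    then show "r A powr ex \<le> zs" using k_pos by simp
    then have "dens zs \<le> dens (r A powr ex)"
      using dens_strict_anti[of "r A powr ex" zs] r(1)[OF A] by (cases "r A powr ex = zs") auto
    then show "dens zs \<le> r A" by (simp add: dens_of_powr r(1)[OF A])
  qed
  have W_upper: "wave_integral (c A) a b \<le> k * (a powr ex - b powr ex) + \<epsilon> A"
    if "0 < A" "dens zs \<le> a" "a \<le> b" "b \<le> M" for A a b
  proof -
    have "0 < a" using that dens_zs_bounds(1) by linarith
    moreover have "wave_integral (c A) a b \<le> wave_integral (c_gen \<alpha> B) a b + \<delta> A / dens zs * M"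
      by (rule wave_integral_le) (use that c_gen_bounds(2)[OF that(1)] \<open>0 < a\<close> \<delta>_nonneg[OF that(1)] dens_zs_bounds(1) in
        \<open>auto intro!: c_cont continuous_on_c_gen\<close>)
    ultimately show ?thesis using that by (simp add: wave_integral_c_gen \<epsilon>_def)
  qed
  have small: "\<forall>\<^sub>F A in at_right 0. 0 < A \<and> A < A1"
    using A1 by (auto simp: eventually_at_right_field intro!: exI[of _ A1])
  have r_lim: "((\<lambda>A. r A powr ex) \<longlongrightarrow> zs) (at_right 0)"
  proof (rule tendsto_sandwich)
    show "\<forall>\<^sub>F A in at_right 0. r A powr ex \<le> zs"
      using small by eventually_elim (use r_lower in auto)
    \<comment> \<open>Each of the two wave integrals contributes \<open>\<epsilon> A\<close>, while
      \<open>r A powr ex\<close> occurs with coefficient \<open>2 * k\<close>; this leaves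
      \<open>\<epsilon> A / k\<close>.\<close>
    show "\<forall>\<^sub>F A in at_right 0. zs - \<epsilon> A / k \<le> r A powr ex"
      using small
    proof eventually_elim
      case (elim A)
      then have A: "0 < A" "A < A1" by auto
      have "k * (zs - zm) + k * (zs - zp) = up - um"
        using us_left us_right by simp
      also have "\<dots> \<le> k * (r A powr ex - zm) + k * (r A powr ex - zp) + 2 * \<epsilon> A"
        using jump[OF A] W_upper[OF A(1) r_lower(1)[OF A] r(2)[OF A]]
          W_upper[OF A(1) r_lower(1)[OF A] r(3)[OF A]]
        by (simp add: M_def zm_def zp_def)
      finally have "k * zs - \<epsilon> A \<le> k * (r A powr ex)" by (simp add: algebra_simps)
      then show ?case using k_pos by (simp add: field_simps)
    qed
    show "((\<lambda>A. zs - \<epsilon> A / k) \<longlongrightarrow> zs) (at_right 0)"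
      using tendsto_diff[OF tendsto_const tendsto_divide_zero[OF \<epsilon>0, of k], of zs] by simp
  qed simp
  have v_bounds: "um + k * (r A powr ex - zm) \<le> v A" "v A \<le> um + k * (r A powr ex - zm) + \<epsilon> A"
    if A: "0 < A" "A < A1" for A
    using v_eq[OF A] W_lower[OF A(1) r(1)[OF A] r(2)[OF A]] W_upper[OF A(1) r_lower(1)[OF A] r(2)[OF A]]
    by (simp_all add: M_def zm_def)
  have v_lim: "(v \<longlongrightarrow> us) (at_right 0)"
  proof (rule tendsto_sandwich)
    show "\<forall>\<^sub>F A in at_right 0. um + k * (r A powr ex - zm) \<le> v A"
      "\<forall>\<^sub>F A in at_right 0. v A \<le> um + k * (r A powr ex - zm) + \<epsilon> A"
      using small by (auto elim!: eventually_mono intro: v_bounds)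
    show "((\<lambda>A. um + k * (r A powr ex - zm)) \<longlongrightarrow> us) (at_right 0)"
      unfolding us_left by (intro tendsto_intros r_lim)
    from tendsto_add[OF this \<epsilon>0]
    show "((\<lambda>A. um + k * (r A powr ex - zm) + \<epsilon> A) \<longlongrightarrow> us) (at_right 0)" by simp
  qed
  have cr_lim: "((\<lambda>A. c A (r A)) \<longlongrightarrow> q * zs) (at_right 0)"
  proof (rule tendsto_sandwich)
    have "q * r A powr ex \<le> c A (r A) \<and> c A (r A) \<le> q * r A powr ex + \<delta> A" if A: "0 < A" "A < A1" for A
      using c_bounds[OF A(1) r(1)[OF A]] r(2)[OF A] by (simp add: M_def)
    then show "\<forall>\<^sub>F A in at_right 0. q * r A powr ex \<le> c A (r A)"
      "\<forall>\<^sub>F A in at_right 0. c A (r A) \<le> q * r A powr ex + \<delta> A"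
      using small by (auto elim!: eventually_mono)
    show "((\<lambda>A. q * r A powr ex) \<longlongrightarrow> q * zs) (at_right 0)"
      by (intro tendsto_intros r_lim)
    from tendsto_add[OF this \<delta>0]
    show "((\<lambda>A. q * r A powr ex + \<delta> A) \<longlongrightarrow> q * zs) (at_right 0)" by simp
  qed
  have cm_lim: "((\<lambda>A. c A \<rho>m) \<longlongrightarrow> q * zm) (at_right 0)"
  proof (rule tendsto_sandwich)
    show "\<forall>\<^sub>F A in at_right 0. q * zm \<le> c A \<rho>m" "\<forall>\<^sub>F A in at_right 0. c A \<rho>m \<le> q * zm + \<delta> A"
      using small c_bounds[OF _ \<rho>m_pos] by (auto elim!: eventually_mono simp: M_def zm_def)
    show "((\<lambda>A. q * zm + \<delta> A) \<longlongrightarrow> q * zm) (at_right 0)"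
      using tendsto_add[OF tendsto_const \<delta>0, of "q * zm"] by simp
  qed simp
  have left_of_2: "\<forall>\<^sub>F A in at_right 0. \<xi> < v A + c A (r A)"
    using order_tendstoD(1)[OF tendsto_add[OF v_lim cr_lim], of \<xi>] \<xi> us_a3 by (simp add: a3_def)

  define Z where "Z A = fst (UA A \<xi>) powr ex" for A
  \<comment> \<open>All three regimes lie on the same 1-wave curve: the left state is its starting
    point and the intermediate state its end. Hence the velocity is controlled by \<open>Z\<close>
    without any case distinction, and only the convergence of \<open>Z\<close> remains.\<close>
  have on_curve: "\<forall>\<^sub>F A in at_right 0. 0 < A \<and> A < A1 \<and> dens zs \<le> fst (UA A \<xi>) \<and> fst (UA A \<xi>) \<le> \<rho>m \<and>
      snd (UA A \<xi>) - um = wave_integral (c A) (fst (UA A \<xi>)) \<rho>m"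
    using small left_of_2
  proof eventually_elim
    case (elim A)
    then have A: "0 < A" "A < A1" by auto
    consider "\<xi> \<le> um - c A \<rho>m" | "um - c A \<rho>m \<le> \<xi>" "\<xi> \<le> v A - c A (r A)" | "v A - c A (r A) \<le> \<xi>"
      by linarith
    then show ?case
    proof cases
      case 1
      then show ?thesis
        using A state_L[OF A] dens_zs_bounds by (simp add: wave_integral_def)
    next
      case 2
      then show ?thesis using A fan[OF A] r_lower(1)[OF A] by auto
    next
      case 3
      then show ?thesis using A state_M[OF A] elim r_lower(1)[OF A] r[OF A] v_eq[OF A] by simp
    qed
  qed
  have u_bounds: "\<forall>\<^sub>F A in at_right 0. um + k * (Z A - zm) \<le> snd (UA A \<xi>) \<and>
      snd (UA A \<xi>) \<le> um + k * (Z A - zm) + \<epsilon> A"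
    using on_curve
  proof eventually_elim
    case (elim A)
    then have A: "0 < A" "0 < fst (UA A \<xi>)" using dens_zs_bounds(1) by auto
    show ?case
      using elim W_lower[OF A(1) A(2), of \<rho>m] W_upper[OF A(1), of "fst (UA A \<xi>)" \<rho>m]
      by (simp add: M_def Z_def zm_def)
  qed

  have Z_lim: "(Z \<longlongrightarrow> zeta \<xi>) (at_right 0)"
  proof -
    consider "\<xi> < a1" | "a2 < \<xi>" | "a1 \<le> \<xi>" "\<xi> \<le> a2" by linarith
    then show ?thesis
    proof cases
      case 1
      have "((\<lambda>A. um - c A \<rho>m) \<longlongrightarrow> a1) (at_right 0)"
        unfolding a1_def by (intro tendsto_intros cm_lim)
      from order_tendstoD(1)[OF this 1] small have "\<forall>\<^sub>F A in at_right 0. Z A = zeta \<xi>"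
      proof eventually_elim
        case (elim A)
        then show ?case using 1 state_L by (simp add: Z_def zeta_left zm_def)
      qed
      then show ?thesis by (rule tendsto_eventually)
    next
      case 2
      have "((\<lambda>A. v A - c A (r A)) \<longlongrightarrow> a2) (at_right 0)"
        unfolding a2_def by (intro tendsto_intros v_lim cr_lim)
      from order_tendstoD(2)[OF this 2] small left_of_2 have "\<forall>\<^sub>F A in at_right 0. Z A = r A powr ex"
      proof eventually_elim
        case (elim A)
        then show ?case using state_M by (simp add: Z_def)
      qed
      moreover have "zeta \<xi> = zs"
        using 2 \<xi> edges by (intro zeta_mid) auto
      ultimately show ?thesis using r_lim by (simp add: tendsto_cong)
    next
      case 3
      have "\<alpha> < 1"
      proof (rule ccontr)
        assume "\<not> \<alpha> < 1"
        then have "\<alpha> = 1" using \<alpha>_le by simp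
        then have "a1 = a2" using a2_eq lam_zero by simp
        then show False using 3 off_line[OF \<open>\<alpha> = 1\<close>] by simp
      qed
      note lam = lam_pos[OF this]
      have zeta: "lam * (zeta \<xi> - zm) = \<xi> - a1"
        using zeta_left_fan[OF \<open>\<alpha> < 1\<close> 3] lam by simp
      have "((\<lambda>A. v A - c A (r A)) \<longlongrightarrow> a2) (at_right 0)"
        unfolding a2_def by (intro tendsto_intros v_lim cr_lim)
      then have before: "\<forall>\<^sub>F A in at_right 0. \<xi> < v A - c A (r A)" if "\<xi> < a2"
        using that by (rule order_tendstoD)
      \<comment> \<open>At \<open>\<xi> = a2\<close> the point may fall on either side of the moving
        fan edge as \<open>A\<close> varies. The bound below therefore adds
        \<open>\<bar>r A powr ex - zs\<bar>\<close>, which covers the intermediate state.\<close>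
      then have fan_or_end: "\<forall>\<^sub>F A in at_right 0. \<xi> < v A - c A (r A) \<or> \<xi> = a2"
        using 3 by (cases "\<xi> = a2") (auto elim!: eventually_mono)
      have "\<forall>\<^sub>F A in at_right 0. norm (Z A - zeta \<xi>) \<le> (\<delta> A + \<epsilon> A) / lam + \<bar>r A powr ex - zs\<bar>"
        using small left_of_2 fan_or_end on_curve u_bounds
      proof eventually_elim
        case (elim A)
        then have A: "0 < A" "A < A1" by auto
        have \<epsilon>A: "0 \<le> \<epsilon> A"
          using elim by linarith
        show ?case
        proof (cases "\<xi> \<le> v A - c A (r A)")
          case True
          \<comment> \<open>The sound speed for \<open>A > 0\<close> is the larger one, so the fan
            for \<open>A\<close> begins at or to the left of \<open>a1\<close>, and the left state
            cannot occur here.\<close>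
          have "um - c A \<rho>m \<le> \<xi>"
            using c_bounds(1)[OF A(1) \<rho>m_pos] 3(1) by (simp add: a1_def M_def zm_def)
          from fan[OF A this True] have F: "\<xi> = snd (UA A \<xi>) - c A (fst (UA A \<xi>))" by simp
          have "0 < fst (UA A \<xi>)" "fst (UA A \<xi>) \<le> M"
            using elim dens_zs_bounds(1) by (auto simp: M_def)
          note cb = c_bounds[OF A(1) this, folded Z_def]
          have "lam * (Z A - zeta \<xi>) = (k * (Z A - zm) + um) - q * Z A - \<xi>"
            using zeta by (simp add: lam_def a1_def algebra_simps)
          \<comment> \<open>The difference is the sum of two errors: the distance from the limiting
            wave curve, at most \<open>\<epsilon> A\<close>, and the error of the sound speed, at
            most \<open>\<delta> A\<close>.\<close>
          then have "lam * (Z A - zeta \<xi>) = (um + k * (Z A - zm) - snd (UA A \<xi>)) + (c A (fst (UA A \<xi>)) - q * Z A)"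
            using F by linarith
          then have "\<bar>lam * (Z A - zeta \<xi>)\<bar> \<le> \<delta> A + \<epsilon> A"
            using cb elim \<epsilon>A \<delta>_nonneg[OF A(1)] by linarith
          then have "lam * \<bar>Z A - zeta \<xi>\<bar> \<le> \<delta> A + \<epsilon> A"
            using lam by (simp only: abs_mult abs_of_pos)
          then have "\<bar>Z A - zeta \<xi>\<bar> \<le> (\<delta> A + \<epsilon> A) / lam"
            using lam by (simp add: pos_le_divide_eq mult.commute)
          then show ?thesis by simp
        next
          case False
          then have "\<xi> = a2" using elim by linarith
          then have "zeta \<xi> = zs"
            using zeta lam by (simp add: a2_eq)
          moreover have "UA A \<xi> = (r A, v A)"
            using False elim by (intro state_M[OF A]) auto
          ultimately show ?thesis using \<epsilon>A \<delta>_nonneg[OF A(1)] lam by (simp add: Z_def)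
        qed
      qed
      moreover have "((\<lambda>A. (\<delta> A + \<epsilon> A) / lam + \<bar>r A powr ex - zs\<bar>) \<longlongrightarrow> 0) (at_right 0)"
        using tendsto_add[OF tendsto_divide_zero[OF tendsto_add_zero[OF \<delta>0 \<epsilon>0], of lam]
          tendsto_rabs_zero[OF LIM_zero[OF r_lim]]] by simp
      ultimately have "((\<lambda>A. Z A - zeta \<xi>) \<longlongrightarrow> 0) (at_right 0)"
        by (rule Lim_null_comparison)
      then show ?thesis by (rule LIM_zero_cancel)
    qed
  qed
  have "((\<lambda>A. dens (Z A)) \<longlongrightarrow> dens (zeta \<xi>)) (at_right 0)"
    unfolding dens_def using zeta_pos[of \<xi>] by (intro tendsto_powr Z_lim tendsto_const) auto
  moreover have "\<forall>\<^sub>F A in at_right 0. dens (Z A) = fst (UA A \<xi>)"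
    using on_curve
  proof eventually_elim
    case (elim A)
    then have "0 < fst (UA A \<xi>)" using dens_zs_bounds(1) by auto
    then show ?case unfolding Z_def by (rule dens_of_powr)
  qed
  ultimately have lim1: "((\<lambda>A. fst (UA A \<xi>)) \<longlongrightarrow> dens (zeta \<xi>)) (at_right 0)"
    by (simp add: tendsto_cong)
  have lim2: "((\<lambda>A. snd (UA A \<xi>)) \<longlongrightarrow> vel \<xi>) (at_right 0)"
  proof (rule tendsto_sandwich)
    show "\<forall>\<^sub>F A in at_right 0. um + k * (Z A - zm) \<le> snd (UA A \<xi>)"
      "\<forall>\<^sub>F A in at_right 0. snd (UA A \<xi>) \<le> um + k * (Z A - zm) + \<epsilon> A"
      using u_bounds by (auto elim!: eventually_mono)
    show *: "((\<lambda>A. um + k * (Z A - zm)) \<longlongrightarrow> vel \<xi>) (at_right 0)"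
      using \<xi> by (auto simp: vel_def intro!: tendsto_intros Z_lim)
    from tendsto_add[OF * \<epsilon>0]
    show "((\<lambda>A. um + k * (Z A - zm) + \<epsilon> A) \<longlongrightarrow> vel \<xi>) (at_right 0)" by simp
  qed
  show ?thesis using tendsto_Pair[OF lim1 lim2] by (simp add: U_def)
qed

text \<open>Reflection turns the 2-wave into a 1-wave. The sign changes match because the oriented
  wave integral changes sign with its end points.\<close>

lemma two_rarefaction_solution_reflected:
  assumes "two_rarefaction_solution c (\<rho>m, um) (\<rho>p, up) V"
  shows "two_rarefaction_solution c (\<rho>p, - up) (\<rho>m, - um) (\<lambda>\<xi>. (fst (V (- \<xi>)), - snd (V (- \<xi>))))"
proof -
  obtain r v where *: "0 < r" "r \<le> \<rho>m" "r \<le> \<rho>p"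
    "up - um = wave_integral c r \<rho>m + wave_integral c r \<rho>p"
    "v - um = - wave_integral c \<rho>m r"
    "\<forall>\<xi>. \<xi> \<le> um - c \<rho>m \<longrightarrow> V \<xi> = (\<rho>m, um)"
    "\<forall>\<xi>. um - c \<rho>m \<le> \<xi> \<and> \<xi> \<le> v - c r \<longrightarrow>
      r \<le> fst (V \<xi>) \<and> fst (V \<xi>) \<le> \<rho>m \<and> \<xi> = snd (V \<xi>) - c (fst (V \<xi>)) \<and>
      snd (V \<xi>) - um = - wave_integral c \<rho>m (fst (V \<xi>))"
    "\<forall>\<xi>. v - c r \<le> \<xi> \<and> \<xi> \<le> v + c r \<longrightarrow> V \<xi> = (r, v)"
    "\<forall>\<xi>. v + c r \<le> \<xi> \<and> \<xi> \<le> up + c \<rho>p \<longrightarrow>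
      r \<le> fst (V \<xi>) \<and> fst (V \<xi>) \<le> \<rho>p \<and> \<xi> = snd (V \<xi>) + c (fst (V \<xi>)) \<and>
      up - snd (V \<xi>) = wave_integral c (fst (V \<xi>)) \<rho>p"
    "\<forall>\<xi>. up + c \<rho>p \<le> \<xi> \<longrightarrow> V \<xi> = (\<rho>p, up)"
    by (rule two_rarefaction_solutionE[OF assms])
  show ?thesis
    unfolding two_rarefaction_solution_def case_prod_beta fst_conv snd_conv
  proof (rule exI[of _ r], rule exI[of _ "- v"], intro conjI allI impI)
    \<comment> \<open>The definition ties the intermediate velocity to the left state only; its
      relation to the right state is obtained by subtracting this from the equation for the total
      velocity jump.\<close>
    show "- um - (- up) = wave_integral c r \<rho>p + wave_integral c r \<rho>m"
      "- v - - up = - wave_integral c \<rho>p r"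
      using *(4,5) wave_integral_swap[of c r \<rho>p] wave_integral_swap[of c r \<rho>m] by linarith+
  next
    fix \<xi> assume "- up - c \<rho>p \<le> \<xi> \<and> \<xi> \<le> - v - c r"
    then show "r \<le> fst (V (- \<xi>))" "fst (V (- \<xi>)) \<le> \<rho>p" "\<xi> = - snd (V (- \<xi>)) - c (fst (V (- \<xi>)))"
      "- snd (V (- \<xi>)) - - up = - wave_integral c \<rho>p (fst (V (- \<xi>)))"
      using *(9)[rule_format, of "- \<xi>"] wave_integral_swap[of c \<rho>p] by auto
  next
    fix \<xi> assume "- v + c r \<le> \<xi> \<and> \<xi> \<le> - um + c \<rho>m"
    then show "r \<le> fst (V (- \<xi>))" "fst (V (- \<xi>)) \<le> \<rho>m" "\<xi> = - snd (V (- \<xi>)) + c (fst (V (- \<xi>)))"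
      "- um - - snd (V (- \<xi>)) = wave_integral c (fst (V (- \<xi>))) \<rho>m"
      using *(7)[rule_format, of "- \<xi>"] wave_integral_swap[of c \<rho>m] by auto
  qed (use *(1-3,6,8,10) in \<open>auto\<close>)
qed

lemma U_limit:
  assumes n: "1 \<le> n" and A1: "0 < A1"
    and sol: "\<And>A. 0 < A \<Longrightarrow> A < A1 \<Longrightarrow>
      two_rarefaction_solution (c_ext n \<alpha> A B) (\<rho>m, um) (\<rho>p, up) (UA A)"
    and off_lines: "\<alpha> = 1 \<Longrightarrow> \<xi> \<noteq> a1 \<and> \<xi> \<noteq> a4"
  shows "((\<lambda>A. UA A \<xi>) \<longlongrightarrow> U \<xi>) (at_right 0)"
proof (cases "\<xi> \<le> us")
  case True
  then show ?thesis using left_half_limit assms by blast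
next
  case False
  interpret r: chaplygin_data \<alpha> B \<rho>p "- up" \<rho>m "- um" by (rule reflected)
  have le: "- \<xi> \<le> r.us" and off: "\<alpha> = 1 \<Longrightarrow> - \<xi> \<noteq> r.a1"
    using False off_lines unfolding reflected_simps by simp_all
  have "((\<lambda>A. (fst (UA A (- (- \<xi>))), - snd (UA A (- (- \<xi>))))) \<longlongrightarrow> r.U (- \<xi>)) (at_right 0)"
    by (rule r.left_half_limit[OF n A1, of "\<lambda>A \<xi>. (fst (UA A (- \<xi>)), - snd (UA A (- \<xi>)))"])
      (use le off two_rarefaction_solution_reflected[OF sol] in blast)+
  then have "((\<lambda>A. (fst (UA A \<xi>), - snd (UA A \<xi>))) \<longlongrightarrow> (dens (zeta \<xi>), - vel \<xi>)) (at_right 0)"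
    by (simp add: r.U_def reflected_simps)
  from tendsto_fst[OF this] tendsto_minus[OF tendsto_snd[OF this]]
  have "((\<lambda>A. (fst (UA A \<xi>), snd (UA A \<xi>))) \<longlongrightarrow> (dens (zeta \<xi>), vel \<xi>)) (at_right 0)"
    by (intro tendsto_Pair) simp_all
  then show ?thesis by (simp add: U_def)
qed

end

theorem theorem5p2:
  fixes n \<alpha> B \<rho>m um \<rho>p up A1 :: real
    and UA :: "real \<Rightarrow> real \<Rightarrow> state"
  assumes "1 \<le> n" "n \<le> 3" "0 < \<alpha>" "\<alpha> \<le> 1" "0 < B" "0 < \<rho>m" "0 < \<rho>p"
    and "(\<rho>p, up) \<in> region_I \<alpha> B (\<rho>m, um)"
    and "0 < A1"
    and "\<forall>A. 0 < A \<and> A < A1 \<longrightarrow> (\<rho>p, up) \<in> R1R2_region n \<alpha> A B (\<rho>m, um)"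
    and "\<forall>A. 0 < A \<and> A < A1 \<longrightarrow>
           two_rarefaction_solution (c_ext n \<alpha> A B) (\<rho>m, um) (\<rho>p, up) (UA A)"
  defines "M \<equiv> (rho_star \<alpha> B (\<rho>m, um) (\<rho>p, up), u_star \<alpha> B (\<rho>m, um) (\<rho>p, up))"
  shows "\<exists>U :: real \<Rightarrow> state.
     (\<forall>\<xi>. (\<alpha> = 1 \<longrightarrow> \<xi> \<noteq> um - c_gen \<alpha> B \<rho>m \<and> \<xi> \<noteq> up + c_gen \<alpha> B \<rho>p) \<longrightarrow>
        ((\<lambda>A. UA A \<xi>) \<longlongrightarrow> U \<xi>) (at_right 0)) \<and>
     (\<alpha> < 1 \<longrightarrow> gen_two_rarefactions \<alpha> B (\<rho>m, um) M (\<rho>p, up) U) \<and>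
     (\<alpha> = 1 \<longrightarrow> gen_two_contacts \<alpha> B (\<rho>m, um) M (\<rho>p, up) U) \<and>
     weak_riemann_solution (P_gen \<alpha> B) (\<rho>m, um) (\<rho>p, up) (\<lambda>x t. U (x / t))"
proof -
  interpret chaplygin_data \<alpha> B \<rho>m um \<rho>p up
    using assms by unfold_locales
  have M: "M = (dens zs, us)"
    by (simp add: M_def rho_star_eq u_star_eq)
  have "((\<lambda>A. UA A \<xi>) \<longlongrightarrow> U \<xi>) (at_right 0)"
    if off_lines: "\<alpha> = 1 \<longrightarrow> \<xi> \<noteq> um - c_gen \<alpha> B \<rho>m \<and> \<xi> \<noteq> up + c_gen \<alpha> B \<rho>p" for \<xi>
  proof (rule U_limit[of n A1])
    show "\<xi> \<noteq> a1 \<and> \<xi> \<noteq> a4" if "\<alpha> = 1"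
      using off_lines that unfolding a1_def a4_def c_gen_values by blast
  qed (use assms in blast)+
  then show ?thesis
    unfolding M using U_rarefactions U_contacts U_weak_solution by blast
qed

end
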